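(* Let $r$ be a positive integer. Then $$\Phi^t_{r-1}(z) = \frac{x_{r+2} z}{1-(x_1 + t x_2) - t \sum_{j=0}^{r-1}(x_{r+2-j} - x_1 x_{r+1-j})}\ {}_{r+2} \phi _{r+1}\left[\begin{array}{c} q, a_1, \ldots, a_{r+1} \\ b_1, \ldots, b_{r+1}\end{array}; q, \frac{b_1 \cdots b_{r+1}}{q^{r+1} a_1 \cdots a_{r+1}} z\right].$$
   Context: $q$ is a formal parameter, $[n]=(1-q^n)/(1-q)$. For an index $\mathbf k=(k_1,\dots,k_l)$ of positive integers, $Li_{\mathbf k;q}(z)=\sum_{m_1>\cdots>m_l\ge1}\frac{z^{m_1}}{[m_1]^{k_1}\cdots[m_l]^{k_l}}$, $Li^t_{\mathbf k;q}(z)=\sum_{\mathbf p}Li_{\mathbf p;q}(z)t^{l-\mathrm{dep}(\mathbf p)}$, $\mathbf p$ running over indices $(k_1\,\square\cdots\square\,k_l)$ with each $\square$ filled by ``$,$'' or ``$+$''. The $i$-height is $\#\{j:k_j\ge i+1\}$. For $k,l,h_1,\dots,h_r\ge0$, $I_{r-1}(k,l,h_1,\dots,h_r)$ is the set of indices of weight $k$, depth $l$, $i$-height $h_i$ ($i=1,\dots,r$) with $k_1\ge r+1$, $G^t_{r-1}=\sum_{\mathbf k\in I_{r-1}}Li^t_{\mathbf k;q}(z)$, and for variables $x_1,\dots,x_{r+2}$, $\Phi^t_{r-1}(z)=\sum_{k,l,h_i\ge0}G^t_{r-1}(k,l,h_1,\dots,h_r;z)x_1^{k-l-\sum_i h_i}x_2^{l-h_1}x_3^{h_1-h_2}\cdots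 x_{r+1}^{h_{r-1}-h_r}x_{r+2}^{h_r}$. Let $\alpha_1,\dots,\alpha_{r+1}$ be determined by $\sum_i\alpha_i=(1-t)x_2-x_1$ and $e_j(\alpha)=(1-t)(x_{j+1}-x_1x_j)$ for $j=2,\dots,r+1$, and $\beta_1,\dots,\beta_{r+1}$ by $\sum_i\beta_i=-(x_1+tx_2)$ and $e_j(\beta)=-t(x_{j+1}-x_1x_j)$ for $j=2,\dots,r+1$ ($e_j$ elementary symmetric polynomials); $a_i=q/(1+(1-q)\alpha_i)$, $b_i=q^2/(1+(1-q)\beta_i)$. $(a;q)_n=\prod_{i=0}^{n-1}(1-aq^i)$, $(a_1,\dots,a_m;q)_n=\prod_i(a_i;q)_n$, ${}_{s+1}\phi_s\left[\begin{array}{c}a_1,\dots,a_{s+1}\\ b_1,\dots,b_s\end{array};q,w\right]=\sum_{n\ge0}\frac{(a_1,\dots,a_{s+1};q)_n}{(q,b_1,\dots,b_s;q)_n}w^n$. *)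

theory Defs
  imports
    "HOL-Library.Multiset_Order"
    "HOL-Computational_Algebra.Formal_Power_Series"
    "HOL-Computational_Algebra.Fraction_Field"
    "HOL-Algebra.Algebraic_Closure_Type"
begin

section \<open>Formal power series in the variables x_0, x_1, x_2, ...\<close>

text \<open>A monomial is the finite multiset of (the indices of) its variables.\<close>

typedef 'a mpser = "UNIV :: (nat multiset \<Rightarrow> 'a) set"
  morphisms mcoeff Abs_mpser ..

setup_lifting type_definition_mpser

lemma mpser_eqI: "(\<And>M. mcoeff f M = mcoeff g M) \<Longrightarrow> f = g"
  by transfer auto

lemma mcoeff_Abs [simp]: "mcoeff (Abs_mpser c) = c"
  by (simp add: Abs_mpser_inverse)

lemma finite_subset_mset: "finite {A. A \<subseteq># (M :: 'b multiset)}"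
proof (induction M)
  case (add x M)
  have "{A. A \<subseteq># add_mset x M} \<subseteq> {A. A \<subseteq># M} \<union> add_mset x ` {A. A \<subseteq># M}"
  proof
    fix A assume "A \<in> {A. A \<subseteq># add_mset x M}"
    then have A: "A \<subseteq># add_mset x M" by simp
    show "A \<in> {A. A \<subseteq># M} \<union> add_mset x ` {A. A \<subseteq># M}"
    proof (cases "x \<in># A")
      case True
      then obtain B where B: "A = add_mset x B" by (meson mset_add)
      with A show ?thesis by auto
    next
      case False
      have "count A y \<le> count M y" for y
        using mset_subset_eq_count[OF A, of y] False by (cases "y = x") (auto simp: not_in_iff)
      then have "A \<subseteq># M" by (rule mset_subset_eqI)
      then show ?thesis by simp
    qed
  qed
  with add show ?case by (meson finite_UnI finite_imageI finite_subset)
qed auto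

lemma finite_mset_splits: "finite {(A, B). A + B = (M :: 'b multiset)}"
  by (rule finite_subset[of _ "{A. A \<subseteq># M} \<times> {A. A \<subseteq># M}"])
     (auto simp: finite_subset_mset)

instantiation mpser :: (comm_ring_1) comm_ring_1
begin

lift_definition zero_mpser :: "'a mpser" is "\<lambda>_. 0" .
lift_definition one_mpser :: "'a mpser" is "\<lambda>M. if M = {#} then 1 else 0" .
lift_definition plus_mpser :: "'a mpser \<Rightarrow> 'a mpser \<Rightarrow> 'a mpser" is "\<lambda>f g M. f M + g M" .
lift_definition minus_mpser :: "'a mpser \<Rightarrow> 'a mpser \<Rightarrow> 'a mpser" is "\<lambda>f g M. f M - g M" .
lift_definition uminus_mpser :: "'a mpser \<Rightarrow> 'a mpser" is "\<lambda>f M. - f M" .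
lift_definition times_mpser :: "'a mpser \<Rightarrow> 'a mpser \<Rightarrow> 'a mpser"
  is "\<lambda>f g M. \<Sum>(A, B) | A + B = M. f A * g B" .

instance
proof
  fix f g h :: "'a mpser"
  show "f * g * h = f * (g * h)"
  proof (transfer, rule ext)
    fix f g h :: "nat multiset \<Rightarrow> 'a" and M
    have "(\<Sum>(A, B) | A + B = M. (\<Sum>(C, D) | C + D = A. f C * g D) * h B)
        = (\<Sum>p\<in>{(A, B). A + B = M}. \<Sum>s\<in>{(C, D). C + D = fst p}. f (fst s) * g (snd s) * h (snd p))"
      by (simp add: sum_distrib_right case_prod_beta)
    also have "\<dots> = (\<Sum>(p, s)\<in>Sigma {(A, B). A + B = M} (\<lambda>p. {(C, D). C + D = fst p}).
                      f (fst s) * g (snd s) * h (snd p))"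
      by (rule sum.Sigma) (auto simp: finite_mset_splits)
    also have "\<dots> = (\<Sum>(p, s)\<in>Sigma {(A, B). A + B = M} (\<lambda>p. {(C, D). C + D = snd p}).
                      f (fst p) * (g (fst s) * h (snd s)))"
      by (rule sum.reindex_bij_witness[of _
            "\<lambda>(p, s). ((fst p + fst s, snd s), (fst p, fst s))"
            "\<lambda>(p, s). ((fst s, snd s + snd p), (snd s, snd p))"])
         (auto simp: mult.assoc add.assoc)
    also have "\<dots> = (\<Sum>p\<in>{(A, B). A + B = M}. \<Sum>s\<in>{(C, D). C + D = snd p}.
                      f (fst p) * (g (fst s) * h (snd s)))"
      by (rule sum.Sigma[symmetric]) (auto simp: finite_mset_splits)
    also have "\<dots> = (\<Sum>(A, B) | A + B = M. f A * (\<Sum>(C, D) | C + D = B. g C * h D))"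
      by (simp add: sum_distrib_left case_prod_beta)
    finally show "(\<Sum>(A, B) | A + B = M. (\<Sum>(C, D) | C + D = A. f C * g D) * h B)
      = (\<Sum>(A, B) | A + B = M. f A * (\<Sum>(C, D) | C + D = B. g C * h D))" .
  qed
  show "f * g = g * f"
    by (transfer, rule ext, rule sum.reindex_bij_witness[of _ prod.swap prod.swap])
       (auto simp: mult.commute add.commute)
  show "1 * f = f"
  proof (transfer, rule ext)
    fix f :: "nat multiset \<Rightarrow> 'a" and M
    have "(\<Sum>(A, B) | A + B = M. (if A = {#} then 1 else 0) * f B)
        = (\<Sum>p\<in>{({#} :: nat multiset, M)}. case p of (A, B) \<Rightarrow> (if A = {#} then 1 else 0) * f B)"
      by (rule sum.mono_neutral_right) (auto simp: finite_mset_splits split: if_splits)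
    then show "(\<Sum>(A, B) | A + B = M. (if A = {#} then 1 else 0) * f B) = f M"
      by simp
  qed
  show "(f + g) * h = f * h + g * h"
    by transfer (auto simp: distrib_right sum.distrib case_prod_beta)
  show "(0 :: 'a mpser) \<noteq> 1"
    by transfer (auto dest: fun_cong[of _ _ "{#}"])
qed (transfer; simp add: fun_eq_iff algebra_simps)+

end

lemma mcoeff_mult: "mcoeff (f * g) M = (\<Sum>(A, B) | A + B = M. mcoeff f A * mcoeff g B)"
  by transfer simp

text \<open>The lowest term of a product with respect to the multiset order, which is a well-order
  compatible with multiplication of monomials, is the product of the lowest terms.\<close>

instance mpser :: (idom) idom
proof
  fix f g :: "'a mpser"
  assume "f \<noteq> 0" "g \<noteq> 0"
  then have ex: "\<exists>A. mcoeff f A \<noteq> 0" "\<exists>B. mcoeff g B \<noteq> 0"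
    by (transfer, auto simp: fun_eq_iff)+
  define a where "a = (LEAST A. mcoeff f A \<noteq> 0)"
  define b where "b = (LEAST B. mcoeff g B \<noteq> 0)"
  have a: "mcoeff f a \<noteq> 0" and b: "mcoeff g b \<noteq> 0"
    unfolding a_def b_def using LeastI_ex[OF ex(1)] LeastI_ex[OF ex(2)] by auto
  have fa: "mcoeff f A = 0" if "A < a" for A
    using that not_less_Least unfolding a_def by blast
  have gb: "mcoeff g B = 0" if "B < b" for B
    using that not_less_Least unfolding b_def by blast
  have "mcoeff (f * g) (a + b) = (\<Sum>p\<in>{(a, b)}. case p of (A, B) \<Rightarrow> mcoeff f A * mcoeff g B)"
    unfolding mcoeff_mult
  proof (rule sum.mono_neutral_right)
    show "\<forall>p\<in>{(A, B). A + B = a + b} - {(a, b)}. (case p of (A, B) \<Rightarrow> mcoeff f A * mcoeff g B) = 0"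
    proof
      fix p assume "p \<in> {(A, B). A + B = a + b} - {(a, b)}"
      then obtain A B where p: "p = (A, B)" and AB: "A + B = a + b" and ne: "(A, B) \<noteq> (a, b)"
        by auto
      have "A < a \<or> B < b"
      proof (rule ccontr)
        assume "\<not> (A < a \<or> B < b)"
        then have le: "a \<le> A" "b \<le> B" by auto
        with ne AB have "a < A \<or> b < B" by auto
        with le have "a + b < A + B"
          using add_less_le_mono add_le_less_mono by blast
        with AB show False by simp
      qed
      then show "(case p of (A, B) \<Rightarrow> mcoeff f A * mcoeff g B) = 0" using fa gb p by auto
    qed
  qed (auto simp: finite_mset_splits)
  with a b have "mcoeff (f * g) (a + b) \<noteq> 0" by simp
  then show "f * g \<noteq> 0" by (metis zero_mpser.rep_eq)
qed

definition mconst :: "'a::comm_ring_1 \<Rightarrow> 'a mpser" where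
  "mconst c = Abs_mpser (\<lambda>M. if M = {#} then c else 0)"

definition mmon :: "nat multiset \<Rightarrow> 'a::comm_ring_1 mpser" where
  "mmon A = Abs_mpser (\<lambda>M. if M = A then 1 else 0)"

definition mvar :: "nat \<Rightarrow> 'a::comm_ring_1 mpser" where
  "mvar i = mmon {#i#}"

lemma mmon_mult: "mmon A * mmon B = mmon (A + B)"
proof (rule mpser_eqI)
  fix M :: "nat multiset"
  have fin: "finite {p. fst p + snd p = M}"
    using finite_mset_splits[of M] by (simp add: case_prod_unfold)
  have "(\<Sum>p | fst p + snd p = M. (if p = (A, B) then 1 else 0 :: 'a)) = (if M = A + B then 1 else 0)"
    unfolding sum.delta[OF fin] by auto
  moreover have "mcoeff (mmon A * mmon B :: 'a mpser) M
      = (\<Sum>p | fst p + snd p = M. (if p = (A, B) then 1 else 0))"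
    unfolding mcoeff_mult case_prod_unfold by (rule sum.cong) (auto simp: mmon_def prod_eq_iff)
  ultimately show "mcoeff (mmon A * mmon B :: 'a mpser) M = mcoeff (mmon (A + B)) M"
    by (simp add: mmon_def)
qed

lemma mmon_empty: "mmon {#} = 1"
  by (rule mpser_eqI) (simp add: mmon_def one_mpser.rep_eq)

lemma mvar_power: "mvar i ^ n = mmon (replicate_mset n i)"
  by (induction n) (simp_all add: mmon_empty mvar_def mmon_mult)

lemma mmon_prod: "(\<Prod>i\<in>I. mmon (f i)) = mmon (\<Sum>i\<in>I. f i)"
  by (induction I rule: infinite_finite_induct) (simp_all add: mmon_empty mmon_mult)

lemma mcoeff_mconst_mmon: "mcoeff (mconst c * mmon A) M = (if M = A then c else 0)"
proof -
  have fin: "finite {p. fst p + snd p = M}"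
    using finite_mset_splits[of M] by (simp add: case_prod_unfold)
  have "(\<Sum>p | fst p + snd p = M. (if p = ({#}, A) then c else 0)) = (if M = A then c else 0)"
    unfolding sum.delta[OF fin] by auto
  moreover have "mcoeff (mconst c * mmon A) M
      = (\<Sum>p | fst p + snd p = M. (if p = ({#}, A) then c else 0))"
    unfolding mcoeff_mult case_prod_unfold
    by (rule sum.cong) (auto simp: mmon_def mconst_def prod_eq_iff)
  ultimately show ?thesis by simp
qed

text \<open>The sum of a family in which every monomial occurs only finitely often.\<close>

definition formal_sum :: "('i \<Rightarrow> 'a::comm_ring_1 mpser) \<Rightarrow> 'i set \<Rightarrow> 'a mpser" where
  "formal_sum f I = Abs_mpser (\<lambda>M. \<Sum>i | i \<in> I \<and> mcoeff (f i) M \<noteq> 0. mcoeff (f i) M)"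

text \<open>The coefficient field in which the \<open>\<alpha>\<^sub>i\<close> and \<open>\<beta>\<^sub>i\<close> live: an algebraic closure of the
  fraction field of the ring of power series in the \<open>x\<^sub>i\<close>.\<close>

type_synonym 'k coeff_field = "'k mpser fract alg_closure"

definition emb :: "'k::field mpser \<Rightarrow> 'k coeff_field" where
  "emb f = to_ac (Fract f 1)"

definition cst :: "'k::field \<Rightarrow> 'k coeff_field" where
  "cst c = emb (mconst c)"

definition xvar :: "nat \<Rightarrow> 'k::field coeff_field" where
  "xvar i = emb (mvar i)"

lemma emb_ring_hom [simp]:
  "emb 0 = 0" "emb 1 = 1" "emb (f + g) = emb f + emb g" "emb (f * g) = emb f * emb g"
proof -
  show "emb 0 = 0" "emb 1 = 1"
    unfolding emb_def Zero_fract_def[symmetric] One_fract_def[symmetric]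
    by (rule to_ac_0 to_ac_1)+
  show "emb (f + g) = emb f + emb g" "emb (f * g) = emb f * emb g"
    unfolding emb_def to_ac_add[symmetric] to_ac_mult[symmetric] by simp_all
qed

lemma emb_inject [simp]: "emb f = emb g \<longleftrightarrow> f = g"
  by (simp add: emb_def eq_fract)


section \<open>Interpolated q-multiple polylogarithms\<close>

definition qint :: "'k::field \<Rightarrow> nat \<Rightarrow> 'k" where
  "qint q n = (1 - q ^ n) / (1 - q)"

text \<open>The coefficient of \<open>z\<^sup>n\<close> collects the tuples \<open>m\<^sub>1 > \<dots> > m\<^sub>l \<ge> 1\<close> with \<open>m\<^sub>1 = n\<close>
  (for the empty index the series is 1).\<close>

definition qLi :: "'k::field \<Rightarrow> nat list \<Rightarrow> 'k fps" where
  "qLi q ks = Abs_fps (\<lambda>n.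
     \<Sum>ms | length ms = length ks \<and> sorted_wrt (>) ms \<and> (\<forall>m\<in>set ms. m \<ge> 1)
            \<and> (case ms of [] \<Rightarrow> n = 0 | m # _ \<Rightarrow> m = n).
       1 / (\<Prod>i<length ks. qint q (ms ! i) ^ (ks ! i)))"

text \<open>The results of filling the boxes of \<open>(k\<^sub>1 \<box> \<dots> \<box> k\<^sub>l)\<close>, one list entry per filling: the
  first box is filled by a comma in the first half of the list, by a plus in the second.\<close>

fun fillings :: "nat list \<Rightarrow> nat list list" where
  "fillings [] = [[]]"
| "fillings [k] = [[k]]"
| "fillings (k # k' # ks) =
     map (\<lambda>p. k # p) (fillings (k' # ks)) @ map (\<lambda>p. (k + hd p) # tl p) (fillings (k' # ks))"

definition qLi_t :: "'k::field \<Rightarrow> 'k \<Rightarrow> nat list \<Rightarrow> 'k fps" where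
  "qLi_t q t ks = (\<Sum>p\<leftarrow>fillings ks. qLi q p * fps_const (t ^ (length ks - length p)))"

definition height :: "nat \<Rightarrow> nat list \<Rightarrow> nat" where
  "height i ks = card {j. j < length ks \<and> ks ! j \<ge> i + 1}"

text \<open>Lists are indexed from 0: \<open>hs ! (i - 1)\<close> is \<open>h\<^sub>i\<close>. The set \<open>I\<^bsub>r-1\<^esub>\<close>, the sums
  \<open>G\<^bsub>r-1\<^esub>\<close> and the series \<open>\<Phi>\<^bsub>r-1\<^esub>\<close> are parametrised by \<open>r\<close>.\<close>

definition idx_set :: "nat \<Rightarrow> nat \<Rightarrow> nat \<Rightarrow> nat list \<Rightarrow> nat list set" where
  "idx_set r k l hs = {ks. (\<forall>m\<in>set ks. m \<ge> 1) \<and> sum_list ks = k \<and> length ks = l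
     \<and> (\<forall>i\<in>{1..r}. height i ks = hs ! (i - 1)) \<and> ks \<noteq> [] \<and> hd ks \<ge> r + 1}"

definition G_t :: "'k::field \<Rightarrow> 'k \<Rightarrow> nat \<Rightarrow> nat \<Rightarrow> nat \<Rightarrow> nat list \<Rightarrow> 'k fps" where
  "G_t q t r k l hs = (\<Sum>ks\<in>idx_set r k l hs. qLi_t q t ks)"

text \<open>The exponents are truncated differences; where truncation would matter, the set
  \<open>idx_set r k l hs\<close> is empty and the term vanishes.\<close>

definition xmon :: "nat \<Rightarrow> nat \<Rightarrow> nat \<Rightarrow> nat list \<Rightarrow> 'k::field mpser" where
  "xmon r k l hs =
     mvar 1 ^ (k - l - sum_list hs) * mvar 2 ^ (l - hs ! 0)
     * (\<Prod>i=1..<r. mvar (i + 2) ^ (hs ! (i - 1) - hs ! i))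
     * mvar (r + 2) ^ (hs ! (r - 1))"

definition Phi_t :: "'k::field \<Rightarrow> 'k \<Rightarrow> nat \<Rightarrow> 'k mpser fps" where
  "Phi_t q t r = Abs_fps (\<lambda>n.
     formal_sum (\<lambda>(k, l, hs). mconst (fps_nth (G_t q t r k l hs) n) * xmon r k l hs)
       {(k, l, hs). length hs = r})"

text \<open>The family summed up in \<^const>\<open>Phi_t\<close> is locally finite.\<close>

lemma height_mono: "i \<le> i' \<Longrightarrow> height i' ks \<le> height i ks"
  unfolding height_def by (rule card_mono) auto

lemma height_le_length: "height i ks \<le> length ks"
proof -
  have "card {j. j < length ks \<and> ks ! j \<ge> i + 1} \<le> card {..<length ks}"
    by (rule card_mono) auto
  then show ?thesis by (simp add: height_def)
qed

lemma Phi_t_locally_finite: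
  assumes "r \<ge> 1"
  shows "finite {(k, l, hs). length hs = r \<and>
           mcoeff (mconst (fps_nth (G_t q t r k l hs) n) * xmon r k l hs) M \<noteq> 0}"
proof (rule finite_subset)
  let ?N = "size M"
  show "finite ({..?N + r * ?N} \<times> {..?N} \<times> {hs. set hs \<subseteq> {..?N} \<and> length hs = r})"
    by (intro finite_cartesian_product finite_lists_length_eq) auto
  show "{(k, l, hs). length hs = r \<and>
           mcoeff (mconst (fps_nth (G_t q t r k l hs) n) * xmon r k l hs) M \<noteq> 0}
      \<subseteq> {..?N + r * ?N} \<times> {..?N} \<times> {hs. set hs \<subseteq> {..?N} \<and> length hs = r}"
  proof (clarify, goal_cases)
    case (1 k l hs)
    define A where "A = replicate_mset (k - l - sum_list hs) 1 + replicate_mset (l - hs ! 0) 2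
      + (\<Sum>i=1..<r. replicate_mset (hs ! (i - 1) - hs ! i) (i + 2))
      + replicate_mset (hs ! (r - 1)) (r + 2)"
    have "xmon r k l hs = (mmon A :: 'a mpser)"
      by (simp add: xmon_def A_def mvar_power mmon_prod mmon_mult add.assoc)
    with 1 have MA: "M = A" and "G_t q t r k l hs \<noteq> 0"
      by (auto simp: mcoeff_mconst_mmon split: if_splits)
    then obtain ks where "ks \<in> idx_set r k l hs"
      unfolding G_t_def by (meson sum.not_neutral_contains_not_neutral)
    then have ks: "length ks = l" "\<And>i. i \<in> {1..r} \<Longrightarrow> hs ! (i - 1) = height i ks"
      by (auto simp: idx_set_def)
    have hh: "hs ! i = height (i + 1) ks" if "i < r" for i
      using ks(2)[of "i + 1"] that by simp
    have tele: "(\<Sum>i=1..<m. hs ! (i - 1) - hs ! i) + hs ! (m - 1) = hs ! 0"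
      if "1 \<le> m" "m \<le> r" for m
      using that
    proof (induction m rule: dec_induct)
      case (step m)
      then have "hs ! m \<le> hs ! (m - 1)"
        using height_mono[of m "m + 1" ks] hh[of m] hh[of "m - 1"] by simp
      with step show ?case by simp
    qed simp
    have h0: "hs ! 0 \<le> l"
      using hh[of 0] height_le_length[of 1 ks] ks(1) assms by simp
    have "size A = (k - l - sum_list hs) + (l - hs ! 0)
        + ((\<Sum>i=1..<r. hs ! (i - 1) - hs ! i) + hs ! (r - 1))"
      by (simp add: A_def size_multiset_sum)
    also have "\<dots> = (k - l - sum_list hs) + l"
      using tele[of r] h0 assms by simp
    finally have N: "?N = (k - l - sum_list hs) + l" using MA by simp
    have hs: "h \<le> l" if "h \<in> set hs" for h
      using that hh height_le_length[of _ ks] ks(1) 1 by (auto simp: in_set_conv_nth)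
    then have "sum_list hs \<le> r * l"
      using sum_list_mono[of hs "\<lambda>h. h" "\<lambda>_. l"] 1 by (simp add: sum_list_triv)
    also have "r * l \<le> r * ?N" using N by simp
    finally have "k \<le> ?N + r * ?N" using N by linarith
    with N hs 1 show ?case by fastforce
  qed
qed


section \<open>Elementary symmetric polynomials and basic hypergeometric series\<close>

definition esym :: "nat \<Rightarrow> (nat \<Rightarrow> 'a::comm_ring_1) \<Rightarrow> nat \<Rightarrow> 'a" where
  "esym n y j = (\<Sum>S | S \<subseteq> {1..n} \<and> card S = j. \<Prod>i\<in>S. y i)"

definition qpoch :: "'a::comm_ring_1 \<Rightarrow> 'a \<Rightarrow> nat \<Rightarrow> 'a" where
  "qpoch a q n = (\<Prod>i<n. 1 - a * q ^ i)"

definition qpochs :: "'a::comm_ring_1 list \<Rightarrow> 'a \<Rightarrow> nat \<Rightarrow> 'a" where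
  "qpochs as q n = (\<Prod>a\<leftarrow>as. qpoch a q n)"

text \<open>The argument \<open>w\<close> is a power series without constant term.\<close>

definition basic_hyp :: "'a::field list \<Rightarrow> 'a list \<Rightarrow> 'a \<Rightarrow> 'a fps \<Rightarrow> 'a fps" where
  "basic_hyp as bs q w =
     fps_compose (Abs_fps (\<lambda>n. qpochs as q n / qpochs (q # bs) q n)) w"

end

theory Submission
  imports Defs
begin

text \<open>
  The coefficient of \<open>z\<^sup>n\<close> in \<open>Li\<^sup>t\<^sub>k\<close> is a sum over weakly decreasing sequences
  \<open>n = m\<^sub>1 \<ge> \<dots> \<ge> m\<^sub>l \<ge> 1\<close>, in which every equality contributes a factor \<open>t\<close>, and the monomial
  attached to \<open>k\<close> is a product over the parts \<open>k\<^sub>j\<close>. Summing over all indices, each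
  value \<open>m < n\<close> therefore contributes the transfer factor \<open>(1 + (1 - t) W) / (1 - t W)\<close>, where
  \<open>W = \<Sum>\<^sub>k u(k) / [m]\<^sup>k\<close> and \<open>u(k)\<close> is the monomial of the part \<open>k\<close>. Multiplied by
  \<open>[m]\<^sup>r ([m] - x\<^sub>1)\<close>, numerator and denominator become the polynomials
  \<open>\<Prod>\<^sub>i ([m] + \<alpha>\<^sub>i)\<close> and \<open>\<Prod>\<^sub>i ([m] + \<beta>\<^sub>i)\<close>. Finally
  \<open>[m] + \<alpha>\<^sub>i\<close> and \<open>[m + 1] + \<beta>\<^sub>i\<close> are constant multiples of
  \<open>1 - a\<^sub>i q\<^bsup>m-1\<^esup>\<close> and \<open>1 - b\<^sub>i q\<^bsup>m-1\<^esup>\<close>.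
\<close>

section \<open>Power series as sums over families of monomials\<close>

lemma mcoeff_add [simp]: "mcoeff (f + g) M = mcoeff f M + mcoeff g M"
  by (simp add: plus_mpser.rep_eq)

lemma mcoeff_0 [simp]: "mcoeff 0 M = 0"
  by (simp add: zero_mpser.rep_eq)

lemma mcoeff_sum: "mcoeff (\<Sum>i\<in>I. f i) M = (\<Sum>i\<in>I. mcoeff (f i) M)"
  by (induction I rule: infinite_finite_induct) auto

lemma mcoeff_mconst_mult: "mcoeff (mconst c * f) M = c * mcoeff f M"
proof -
  have "mcoeff (mconst c * f) M
      = (\<Sum>p\<in>{({#}, M)}. mcoeff (mconst c) (fst p) * mcoeff f (snd p))"
    unfolding mcoeff_mult case_prod_unfold
    by (rule sum.mono_neutral_right)
       (use finite_mset_splits[of M] in \<open>auto simp: case_prod_unfold mconst_def prod_eq_iff\<close>)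
  then show ?thesis by (simp add: mconst_def)
qed

lemma mconst_hom [simp]:
  "mconst 0 = 0" "mconst 1 = 1" "mconst (c + d) = mconst c + mconst d"
  "mconst (c * d) = mconst c * mconst d"
proof -
  show "mconst 0 = 0" "mconst 1 = 1" "mconst (c + d) = mconst c + mconst d"
    by (rule mpser_eqI, simp add: mconst_def one_mpser.rep_eq)+
  show "mconst (c * d) = mconst c * mconst d"
    by (rule mpser_eqI) (simp add: mcoeff_mconst_mult, simp add: mconst_def)
qed

lemma mconst_power [simp]: "mconst (c ^ n) = mconst c ^ n"
  by (induction n) auto

text \<open>The terms \<open>c i\<close> times the monomial \<open>a i\<close> are grouped by the
  fibres of \<open>a\<close> alone. Reindexing and multiplication then concern index sets only,
  without case distinctions on vanishing coefficients.\<close>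

definition mgsum :: "('i \<Rightarrow> 'a::comm_ring_1) \<Rightarrow> ('i \<Rightarrow> nat multiset) \<Rightarrow> 'i set \<Rightarrow> 'a mpser" where
  "mgsum c a I = Abs_mpser (\<lambda>M. \<Sum>i | i \<in> I \<and> a i = M. c i)"

text \<open>Local finiteness, stated without the coefficients. A sum over an infinite fibre would
  take the default value 0, which would break additivity and the product rule.\<close>

definition finite_fibres :: "('i \<Rightarrow> 'b) \<Rightarrow> 'i set \<Rightarrow> bool" where
  "finite_fibres a I \<longleftrightarrow> (\<forall>M. finite {i \<in> I. a i = M})"

lemma finite_fibresD: "finite_fibres a I \<Longrightarrow> finite {i \<in> I. a i = M}"
  by (simp add: finite_fibres_def)

lemma mcoeff_mgsum: "mcoeff (mgsum c a I) M = (\<Sum>i | i \<in> I \<and> a i = M. c i)"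
  by (simp add: mgsum_def)

lemma mgsum_cong:
  "(\<And>i. i \<in> I \<Longrightarrow> c i = d i) \<Longrightarrow> (\<And>i. i \<in> I \<Longrightarrow> a i = b i) \<Longrightarrow> mgsum c a I = mgsum d b I"
  by (rule mpser_eqI) (auto simp: mcoeff_mgsum intro!: sum.cong)

lemma mgsum_add: "mgsum (\<lambda>i. c i + d i) a I = mgsum c a I + mgsum d a I"
  by (rule mpser_eqI) (simp add: mcoeff_mgsum sum.distrib)

lemma mgsum_scale: "mgsum (\<lambda>i. x * c i) a I = mconst x * mgsum c a I"
  by (rule mpser_eqI) (simp add: mcoeff_mgsum sum_distrib_left mcoeff_mconst_mult)

lemma mgsum_Un:
  assumes "finite_fibres a I" "finite_fibres a J" "I \<inter> J = {}"
  shows "mgsum c a (I \<union> J) = mgsum c a I + mgsum c a J"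
proof (rule mpser_eqI)
  fix M
  have "{i \<in> I \<union> J. a i = M} = {i \<in> I. a i = M} \<union> {i \<in> J. a i = M}" by auto
  then show "mcoeff (mgsum c a (I \<union> J)) M = mcoeff (mgsum c a I + mgsum c a J) M"
    using assms by (simp add: mcoeff_mgsum finite_fibres_def) (rule sum.union_disjoint, auto)
qed

lemma mgsum_finite:
  assumes "finite I"
  shows "mgsum c a I = (\<Sum>i\<in>I. mconst (c i) * mmon (a i))"
  by (rule mpser_eqI)
     (auto simp: mcoeff_mgsum mcoeff_sum mcoeff_mconst_mmon assms sum.If_cases Int_def eq_commute
           intro!: sum.cong)

lemma mgsum_reindex:
  assumes "inj_on h I"
  shows "mgsum c a (h ` I) = mgsum (c \<circ> h) (a \<circ> h) I"
proof (rule mpser_eqI)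
  fix M
  have "{i \<in> h ` I. a i = M} = h ` {i \<in> I. a (h i) = M}" by auto
  then show "mcoeff (mgsum c a (h ` I)) M = mcoeff (mgsum (c \<circ> h) (a \<circ> h) I) M"
    using sum.reindex[OF inj_on_subset[OF assms], of "{i \<in> I. a (h i) = M}" c]
    by (simp add: mcoeff_mgsum)
qed

text \<open>A pair (i, j) contributes to M only through the splitting of M into \<open>a i\<close>
  and \<open>b j\<close>, so the sums over all splittings partition the pairs.\<close>

lemma mgsum_mult:
  assumes "finite_fibres a I" "finite_fibres b J"
  shows "mgsum c a I * mgsum d b J = mgsum (\<lambda>(i, j). c i * d j) (\<lambda>(i, j). a i + b j) (I \<times> J)"
proof (rule mpser_eqI)
  fix M
  define Xs where "Xs = (\<lambda>p. {i \<in> I. a i = fst p} \<times> {j \<in> J. b j = snd p})"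
  have "mcoeff (mgsum c a I * mgsum d b J) M
      = (\<Sum>p\<in>{(A, B). A + B = M}. \<Sum>x\<in>Xs p. c (fst x) * d (snd x))"
    by (simp add: mcoeff_mult mcoeff_mgsum sum_product sum.cartesian_product case_prod_unfold Xs_def)
  also have "\<dots> = (\<Sum>(p, x)\<in>Sigma {(A, B). A + B = M} Xs. c (fst x) * d (snd x))"
    using assms by (intro sum.Sigma) (auto simp: finite_mset_splits Xs_def finite_fibres_def)
  also have "\<dots> = (\<Sum>x | x \<in> I \<times> J \<and> (case x of (i, j) \<Rightarrow> a i + b j) = M. case x of (i, j) \<Rightarrow> c i * d j)"
    by (rule sum.reindex_bij_witness[of _ "\<lambda>x. ((a (fst x), b (snd x)), x)" snd])
       (auto simp: Xs_def)
  finally show "mcoeff (mgsum c a I * mgsum d b J) M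
      = mcoeff (mgsum (\<lambda>(i, j). c i * d j) (\<lambda>(i, j). a i + b j) (I \<times> J)) M"
    by (simp add: mcoeff_mgsum)
qed

section \<open>Monomials attached to parts and indices\<close>

definition positive_lists :: "nat list set" where
  "positive_lists = {ks. \<forall>k\<in>set ks. 1 \<le> k}"

text \<open>The share of one part in \<open>xmon\<close>: a part k \<le> r is counted only in the
  exponent of x_{k+1}; a larger part adds one to the exponent of x_{r+2} and its excess over r + 1
  to that of x_1.\<close>

definition part_mon :: "nat \<Rightarrow> nat \<Rightarrow> nat multiset" where
  "part_mon r k = (if k \<le> r then {#k + 1#} else add_mset (r + 2) (replicate_mset (k - r - 1) 1))"

definition index_mon :: "nat \<Rightarrow> nat list \<Rightarrow> nat multiset" where
  "index_mon r ks = (\<Sum>k\<leftarrow>ks. part_mon r k)"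

lemma index_mon_simps [simp]:
  "index_mon r [] = {#}" "index_mon r (k # ks) = part_mon r k + index_mon r ks"
  by (simp_all add: index_mon_def)

lemma finite_fibres_part_mon: "finite_fibres (part_mon r) K"
proof -
  have "{k. part_mon r k = M} \<subseteq> {..r + size M}" for M
    by (auto simp: part_mon_def split: if_splits)
  then have "finite {k. part_mon r k = M}" for M
    using finite_subset by blast
  then show ?thesis by (simp add: finite_fibres_def)
qed

text \<open>Every part has at least one variable and exceeds r by at most the size of its monomial,
  so the total size bounds both the length and the entries of an index.\<close>

lemma finite_fibres_index_mon: "finite_fibres (index_mon r) Xs"
proof -
  have part: "k \<le> r + size (part_mon r k)" "1 \<le> size (part_mon r k)" for k
    by (auto simp: part_mon_def)
  have "set ks \<subseteq> {..r + size (index_mon r ks)} \<and> length ks \<le> size (index_mon r ks)" for ks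
  proof (induction ks)
    case (Cons k ks)
    with part[of k] show ?case by fastforce
  qed auto
  then have "{ks. index_mon r ks = M} \<subseteq> {ks. set ks \<subseteq> {..r + size M} \<and> length ks \<le> size M}" for M
    by auto
  moreover have "finite {ks. set ks \<subseteq> {..r + size M} \<and> length ks \<le> size M}" for M :: "nat multiset"
    by (rule finite_lists_length_le) auto
  ultimately have "finite {ks. index_mon r ks = M}" for M
    using finite_subset by blast
  then show ?thesis by (simp add: finite_fibres_def)
qed

text \<open>Turns a recursion of the coefficients in the first part into an equation between power
  series.\<close>

lemma mgsum_Cons:
  assumes "\<And>k ks. k \<in> K \<Longrightarrow> ks \<in> Xs \<Longrightarrow> c (k # ks) = f k * g ks"
  shows "mgsum c (index_mon r) {k # ks | k ks. k \<in> K \<and> ks \<in> Xs}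
    = mgsum f (part_mon r) K * mgsum g (index_mon r) Xs"
proof -
  have "{k # ks | k ks. k \<in> K \<and> ks \<in> Xs} = (\<lambda>(k, ks). k # ks) ` (K \<times> Xs)" by auto
  moreover have "inj_on (\<lambda>(k, ks). k # ks) (K \<times> Xs)" by (auto simp: inj_on_def)
  ultimately have "mgsum c (index_mon r) {k # ks | k ks. k \<in> K \<and> ks \<in> Xs}
      = mgsum (\<lambda>(k, ks). f k * g ks) (\<lambda>(k, ks). part_mon r k + index_mon r ks) (K \<times> Xs)"
    using assms by (auto simp: mgsum_reindex intro!: mgsum_cong)
  then show ?thesis
    by (simp add: mgsum_mult[OF finite_fibres_part_mon finite_fibres_index_mon])
qed

text \<open>Multiplying by the variable \<open>x\<^sub>1\<close> shifts the exponents of the geometric tail.\<close>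

lemma mgsum_parts_tail:
  fixes N :: "'k::field"
  assumes "N \<noteq> 0"
  shows "mconst N ^ r * (mconst N - mvar 1)
      * mgsum (\<lambda>k. 1 / N ^ k) (part_mon r) {r+1..} = mvar (r + 2)"
proof -
  let ?V = "\<lambda>K. mgsum (\<lambda>k. 1 / N ^ k) (part_mon r) K"
  have split: "{r+1..} = {r+1} \<union> {r+2..}" by auto
  have head: "?V {r+1} = mconst (1 / N ^ (r+1)) * mvar (r + 2)"
    by (subst mgsum_finite) (simp_all add: part_mon_def mvar_def)
  have V: "?V {r+1..} = ?V {r+1} + ?V {r+2..}"
    unfolding split by (rule mgsum_Un) (auto simp: finite_fibres_part_mon)
  \<comment> \<open>A family with one member, so that \<open>mgsum_mult\<close> applies to the
    product with x_1.\<close>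
  have x1: "mvar 1 = mgsum (\<lambda>_. 1 :: 'k) (\<lambda>_. {#1#}) {()}"
    by (subst mgsum_finite) (simp_all add: mvar_def)
  have shift: "part_mon r (Suc k) = {#1#} + part_mon r k" if "k \<ge> r + 1" for k
    using le_Suc_ex[OF that] by (auto simp: part_mon_def)
  have "finite_fibres (\<lambda>_ :: unit. {#1 :: nat#}) {()}"
    by (simp add: finite_fibres_def)
  with x1 have "mvar 1 * ?V {r+1..}
      = mgsum (\<lambda>(i, k). 1 * (1 / N ^ k)) (\<lambda>(i, k). {#1#} + part_mon r k) ({()} \<times> {r+1..})"
    by (simp only: mgsum_mult finite_fibres_part_mon)
  also have "\<dots> = mgsum (\<lambda>k. N * (1 / N ^ k)) (part_mon r) ((\<lambda>(i, k). Suc k) ` ({()} \<times> {r+1..}))"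
    using assms shift by (subst mgsum_reindex) (auto simp: inj_on_def intro!: mgsum_cong)
  also have "(\<lambda>(i::unit, k). Suc k) ` ({()} \<times> {r+1..}) = {r+2..}"
  proof (intro equalityI subsetI)
    fix m assume "m \<in> {r+2..}"
    then show "m \<in> (\<lambda>(i::unit, k). Suc k) ` ({()} \<times> {r+1..})"
      by (intro image_eqI[of _ _ "((), m - 1)"]) auto
  qed auto
  finally have "mvar 1 * ?V {r+1..} = mconst N * ?V {r+2..}"
    by (simp only: mgsum_scale)
  \<comment> \<open>Multiplication by x_1 amounts to dropping the first term and multiplying by N,
    so in the difference only the term k = r + 1 survives.\<close>
  then have "(mconst N - mvar 1) * ?V {r+1..} = mconst N * ?V {r+1}"
    using V by (simp add: algebra_simps)
  then have "mconst N ^ r * (mconst N - mvar 1) * ?V {r+1..}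
      = mconst (N ^ r * N * (1 / N ^ (r+1))) * mvar (r + 2)"
    by (simp only: head mult.assoc mconst_hom mconst_power)
  then show ?thesis using assms by simp
qed

section \<open>Recursion in the first part of the index\<close>

text \<open>The summation range of \<open>qLi\<close> at the coefficient n. The empty tuple counts
  as having leading entry 0, so that a tail of any length has a leading entry m < n.\<close>

definition decreasing_tuples :: "nat \<Rightarrow> nat \<Rightarrow> nat list set" where
  "decreasing_tuples l n = {ms. length ms = l \<and> sorted_wrt (>) ms \<and> (\<forall>m\<in>set ms. m \<ge> 1)
            \<and> (case ms of [] \<Rightarrow> n = 0 | m # _ \<Rightarrow> m = n)}"

lemma decreasing_tuples_0: "decreasing_tuples 0 n = (if n = 0 then {[]} else {})"
  by (auto simp: decreasing_tuples_def)

lemma decreasing_tuples_Suc: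
  "decreasing_tuples (Suc l) n = (\<Union>m<n. (#) n ` decreasing_tuples l m)"
proof (intro equalityI subsetI)
  fix ms assume "ms \<in> decreasing_tuples (Suc l) n"
  then obtain ms' where ms: "ms = n # ms'" "length ms' = l" "n \<ge> 1" "sorted_wrt (>) ms'"
      "\<forall>m\<in>set ms'. m \<ge> 1 \<and> m < n"
    by (cases ms) (auto simp: decreasing_tuples_def)
  then have "ms' \<in> decreasing_tuples l (case ms' of [] \<Rightarrow> 0 | m # _ \<Rightarrow> m)"
    by (auto simp: decreasing_tuples_def split: list.split)
  moreover have "(case ms' of [] \<Rightarrow> 0 | m # _ \<Rightarrow> m) < n"
    using ms by (auto split: list.split)
  ultimately show "ms \<in> (\<Union>m<n. (#) n ` decreasing_tuples l m)"
    using ms(1) by blast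
next
  fix ms assume "ms \<in> (\<Union>m<n. (#) n ` decreasing_tuples l m)"
  then obtain m ms' where "m < n" "ms = n # ms'" "ms' \<in> decreasing_tuples l m" by auto
  then show "ms \<in> decreasing_tuples (Suc l) n"
    by (cases ms') (auto simp: decreasing_tuples_def)
qed

lemma finite_decreasing_tuples: "finite (decreasing_tuples l n)"
  by (induction l arbitrary: n) (auto simp: decreasing_tuples_0 decreasing_tuples_Suc)

lemma qLi_nth: "fps_nth (qLi q ks) n = (\<Sum>ms\<in>decreasing_tuples (length ks) n.
    1 / (\<Prod>i<length ks. qint q (ms ! i) ^ (ks ! i)))"
  by (simp add: qLi_def decreasing_tuples_def)

lemma qLi_Nil_nth: "fps_nth (qLi q []) n = (if n = 0 then 1 else 0)"
  by (simp add: qLi_nth decreasing_tuples_0)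

text \<open>The tuples are grouped by the leading entry m of the tail; the factor belonging to m_1 =
  n is common to all of them.\<close>

lemma qLi_Cons_nth:
  "fps_nth (qLi q (k # ks)) n = 1 / qint q n ^ k * (\<Sum>m<n. fps_nth (qLi q ks) m)"
proof -
  let ?f = "\<lambda>ms. 1 / (\<Prod>i<length (k # ks). qint q (ms ! i) ^ ((k # ks) ! i))"
  have disj: "decreasing_tuples l m \<inter> decreasing_tuples l m' = {}" if "m \<noteq> m'" for l m m'
    proof -
    have "m = m'" if "ms \<in> decreasing_tuples l m" "ms \<in> decreasing_tuples l m'" for ms
      using that by (cases ms) (auto simp: decreasing_tuples_def)
    with that show ?thesis by blast
  qed
  have "fps_nth (qLi q (k # ks)) n = sum ?f (\<Union>m<n. (#) n ` decreasing_tuples (length ks) m)"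
    by (simp add: qLi_nth decreasing_tuples_Suc)
  also have "\<dots> = (\<Sum>m<n. sum ?f ((#) n ` decreasing_tuples (length ks) m))"
    by (intro sum.UNION_disjoint) (simp_all add: finite_decreasing_tuples disj flip: image_Int)
  also have "\<dots> = (\<Sum>m<n. 1 / qint q n ^ k * fps_nth (qLi q ks) m)"
    by (rule sum.cong)
       (simp_all add: sum.reindex qLi_nth prod.lessThan_Suc_shift sum_distrib_left del: prod.lessThan_Suc)
  finally show ?thesis by (simp add: sum_distrib_left)
qed

text \<open>The first bound makes the truncated exponent \<open>length ks - length p\<close> a true
  difference; nonemptiness makes \<open>hd p\<close> and \<open>tl p\<close> meaningful when the
  first box is filled by a plus.\<close>

lemma fillings_length:
  assumes "p \<in> set (fillings ks)"
  shows "length p \<le> length ks" "ks \<noteq> [] \<Longrightarrow> p \<noteq> []"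
proof -
  have "length p \<le> length ks \<and> (ks \<noteq> [] \<longrightarrow> p \<noteq> [])"
    using assms by (induction ks arbitrary: p rule: fillings.induct) fastforce+
  then show "length p \<le> length ks" "ks \<noteq> [] \<Longrightarrow> p \<noteq> []" by auto
qed

lemma qLi_t_nth: "fps_nth (qLi_t q t ks) n
    = (\<Sum>p\<leftarrow>fillings ks. fps_nth (qLi q p) n * t ^ (length ks - length p))"
proof -
  have "fps_nth (sum_list fs) n = (\<Sum>f\<leftarrow>fs. fps_nth f n)" for fs :: "'a fps list"
    by (induction fs) auto
  then show ?thesis by (simp add: qLi_t_def o_def)
qed

lemma qLi_t_Nil_nth: "fps_nth (qLi_t q t []) n = (if n = 0 then 1 else 0)"
  by (simp add: qLi_t_nth qLi_Nil_nth)

lemma qLi_t_nth_0: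
  assumes "ks \<noteq> []"
  shows "fps_nth (qLi_t q t ks) 0 = 0"
proof -
  have "fps_nth (qLi q p) 0 = 0" if "p \<in> set (fillings ks)" for p
    using fillings_length(2)[OF that assms] by (cases p) (simp_all add: qLi_Cons_nth)
  then show ?thesis by (simp add: qLi_t_nth cong: map_cong)
qed

text \<open>The two summands come from filling the first box by a comma and by a plus.\<close>

lemma qLi_t_Cons_nth:
  assumes "n \<ge> 1"
  shows "fps_nth (qLi_t q t (k # ks)) n = 1 / qint q n ^ k *
    ((\<Sum>m<n. fps_nth (qLi_t q t ks) m) + t * fps_nth (qLi_t q t ks) n)"
proof (cases ks)
  case Nil
  \<comment> \<open>The t-summand vanishes here: the series of the empty index is 1, and n \<ge>
    1.\<close>
  then show ?thesis using assms by (simp add: qLi_t_nth qLi_Cons_nth qLi_Nil_nth)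
next
  case (Cons k' ks')
  let ?c = "1 / qint q n ^ k"
  have swap: "(\<Sum>p\<leftarrow>ps. \<Sum>m<n. f p m) = (\<Sum>m<n. \<Sum>p\<leftarrow>ps. f p m)"
    for ps and f :: "nat list \<Rightarrow> nat \<Rightarrow> 'a"
    by (induction ps) (simp_all add: sum.distrib)
  \<comment> \<open>Adding k to the first part only changes the factor belonging to m_1 = n.\<close>
  have plus: "fps_nth (qLi q ((k + hd p) # tl p)) n = ?c * fps_nth (qLi q p) n"
    if "p \<in> set (fillings ks)" for p
    using fillings_length(2)[OF that] Cons
    by (cases p) (simp_all add: qLi_Cons_nth power_add)
  have "(\<Sum>p\<leftarrow>fillings ks. fps_nth (qLi q (k # p)) n * t ^ (length (k # ks) - length (k # p)))
      = (\<Sum>p\<leftarrow>fillings ks. \<Sum>m<n. ?c * (fps_nth (qLi q p) m * t ^ (length ks - length p)))"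
    by (simp add: qLi_Cons_nth sum_distrib_left sum_distrib_right mult.assoc)
  also have "\<dots> = ?c * (\<Sum>m<n. fps_nth (qLi_t q t ks) m)"
    by (simp only: swap sum_list_const_mult qLi_t_nth sum_distrib_left)
  finally have comma: "(\<Sum>p\<leftarrow>fillings ks. fps_nth (qLi q (k # p)) n
      * t ^ (length (k # ks) - length (k # p))) = ?c * (\<Sum>m<n. fps_nth (qLi_t q t ks) m)" .
  have "(\<Sum>p\<leftarrow>fillings ks. fps_nth (qLi q ((k + hd p) # tl p)) n
        * t ^ (length (k # ks) - length ((k + hd p) # tl p)))
      = (\<Sum>p\<leftarrow>fillings ks. ?c * t * (fps_nth (qLi q p) n * t ^ (length ks - length p)))"
  proof (rule arg_cong[of _ _ sum_list], rule map_cong[OF refl])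
    fix p assume p: "p \<in> set (fillings ks)"
    \<comment> \<open>A plus merges two parts, which raises the exponent of t by one.\<close>
    have "length (k # ks) - length ((k + hd p) # tl p) = Suc (length ks - length p)"
      using fillings_length[OF p] Cons by (cases p) auto
    then show "fps_nth (qLi q ((k + hd p) # tl p)) n
          * t ^ (length (k # ks) - length ((k + hd p) # tl p))
        = ?c * t * (fps_nth (qLi q p) n * t ^ (length ks - length p))"
      by (simp only: plus[OF p] power_Suc mult_ac)
  qed
  also have "\<dots> = ?c * t * fps_nth (qLi_t q t ks) n"
    by (simp only: qLi_t_nth sum_list_const_mult)
  finally show ?thesis
    using comma Cons by (simp add: qLi_t_nth o_def distrib_left mult.assoc)
qed

section \<open>Heights and monomials\<close>

lemma height_Cons: "height i (k # ks) = (if k \<ge> i + 1 then 1 else 0) + height i ks"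
proof -
  have "height i ks = length (filter (\<lambda>k. k \<ge> i + 1) ks)" for ks
    by (simp add: height_def length_filter_conv_card)
  then show ?thesis by simp
qed

lemma height_Nil [simp]: "height i [] = 0"
  by (simp add: height_def)

text \<open>Parts equal to i + 1 are those counted by the i-height but not by the next one, so the
  exponents of \<open>xmon\<close> that are differences of heights are multiplicities.\<close>

lemma height_Suc: "height i ks = height (Suc i) ks + count_list ks (Suc i)"
  by (induction ks) (auto simp: height_Cons)

lemma height_0: "ks \<in> positive_lists \<Longrightarrow> height 0 ks = length ks"
  by (induction ks) (auto simp: height_Cons positive_lists_def)

text \<open>A part k consists of 1, of one unit for each i in {1..r} with k \<ge> i + 1, and of its
  excess over r + 1. The total excess is thus the exponent of x_1.\<close>

lemma sum_list_eq_heights: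
  assumes "ks \<in> positive_lists"
  shows "sum_list ks = length ks + (\<Sum>i=1..r. height i ks) + (\<Sum>k\<leftarrow>ks. k - (r + 1))"
  using assms
proof (induction ks)
  case (Cons k ks)
  have "k = 1 + (\<Sum>i=1..r. if k \<ge> i + 1 then 1 else 0) + (k - (r + 1))" if "k \<ge> 1"
    using that by (induction r) auto
  with Cons show ?case
    by (simp add: height_Cons sum.distrib positive_lists_def)
qed simp

definition heights :: "nat \<Rightarrow> nat list \<Rightarrow> nat list" where
  "heights r ks = map (\<lambda>i. height i ks) [1..<r+1]"

lemma mmon_index_mon:
  assumes "ks \<in> positive_lists"
  shows "mvar 1 ^ (\<Sum>k\<leftarrow>ks. k - (r + 1)) * (\<Prod>i<r. mvar (i + 2) ^ count_list ks (i + 1))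
    * mvar (r + 2) ^ height r ks = (mmon (index_mon r ks) :: 'a::comm_ring_1 mpser)"
  using assms
proof (induction ks)
  case Nil
  then show ?case by (simp add: mmon_empty)
next
  case (Cons k ks)
  then have k: "k \<ge> 1" and ks: "ks \<in> positive_lists" by (auto simp: positive_lists_def)
  have part: "mvar 1 ^ (k - (r + 1)) * (\<Prod>i<r. if i + 1 = k then mvar (i + 2) else 1)
      * mvar (r + 2) ^ (if k \<ge> r + 1 then 1 else 0) = (mmon (part_mon r k) :: 'a mpser)"
  proof (cases "k \<le> r")
    case True
    have "(\<Prod>i<r. if i + 1 = k then mvar (i + 2) else 1)
        = (\<Prod>i<r. if i = k - 1 then mvar (i + 2) else (1 :: 'a mpser))"
      using k by (intro prod.cong) auto
    also have "\<dots> = mvar (k + 1)"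
      using k True by simp
    finally show ?thesis using True by (simp add: part_mon_def mvar_def)
  next
    case False
    then have "(\<Prod>i<r. if i + 1 = k then mvar (i + 2) else (1 :: 'a mpser)) = 1"
      by (intro prod.neutral) auto
    with False show ?thesis
      by (simp add: part_mon_def mvar_power mmon_mult) (simp add: mvar_def mmon_mult)
  qed
  have cnt: "(\<Prod>i<r. mvar (i + 2) ^ count_list (k # ks) (i + 1))
      = (\<Prod>i<r. if i + 1 = k then mvar (i + 2) else 1)
        * (\<Prod>i<r. mvar (i + 2) ^ count_list ks (i + 1) :: 'a mpser)"
    unfolding prod.distrib[symmetric] by (rule prod.cong) auto
  show ?case
    unfolding index_mon_simps mmon_mult[symmetric] part[symmetric] Cons.IH[OF ks, symmetric]
      cnt height_Cons
    by (simp add: power_add mult_ac)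
qed

text \<open>The exponents given by weight, depth and heights are additive over the parts, which is
  what makes the generating function over all indices multiplicative.\<close>

lemma xmon_index_mon:
  assumes "r \<ge> 1" "ks \<in> positive_lists"
  shows "xmon r (sum_list ks) (length ks) (heights r ks) = (mmon (index_mon r ks) :: 'k::field mpser)"
proof -
  let ?h = "heights r ks"
  have nth: "?h ! i = height (Suc i) ks" if "i < r" for i
    using that by (simp add: heights_def del: upt_Suc)
  have "sum_list ?h = (\<Sum>i=1..r. height i ks)"
    unfolding heights_def
    by (simp add: sum_list_distinct_conv_sum_set atLeastLessThanSuc_atLeastAtMost del: upt_Suc)
  then have e1: "sum_list ks - length ks - sum_list ?h = (\<Sum>k\<leftarrow>ks. k - (r + 1))"
    using sum_list_eq_heights[OF assms(2), of r] by simp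
  have e2: "length ks - ?h ! 0 = count_list ks 1"
    using nth[of 0] assms height_0 height_Suc[of 0 ks] by simp
  have e3: "?h ! (i - 1) - ?h ! i = count_list ks (i + 1)" if "i \<in> {1..<r}" for i
    using that nth[of i] nth[of "i - 1"] height_Suc[of i ks] less_imp_diff_less[of i r 1] by simp
  have er: "?h ! (r - 1) = height r ks"
    using nth[of "r - 1"] assms(1) by simp
  \<comment> \<open>\<open>xmon\<close> lists the power of x_2 separately; it is the factor i = 0 of
    the full product.\<close>
  have "mvar 2 ^ count_list ks 1 * (\<Prod>i=1..<r. mvar (i + 2) ^ count_list ks (i + 1))
      = (\<Prod>i<r. mvar (i + 2) ^ count_list ks (i + 1) :: 'k mpser)"
    using assms(1) unfolding lessThan_atLeast0
    by (subst (2) prod.atLeast_Suc_lessThan) (simp_all add: numeral_2_eq_2)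
  moreover have "(\<Prod>i=1..<r. mvar (i + 2) ^ (?h ! (i - 1) - ?h ! i))
      = (\<Prod>i=1..<r. mvar (i + 2) ^ count_list ks (i + 1) :: 'k mpser)"
    by (rule prod.cong) (simp_all only: e3)
  ultimately show ?thesis
    unfolding xmon_def mmon_index_mon[OF assms(2), symmetric] e1 e2 er
    by (simp only: mult.assoc)
qed

section \<open>The series \<open>Phi_t\<close> as one sum over admissible indices\<close>

definition admissible_lists :: "nat \<Rightarrow> nat list set" where
  "admissible_lists r = {k # ks | k ks. k \<in> {r+1..} \<and> ks \<in> positive_lists}"

text \<open>Weight, depth and heights partition the admissible indices, so a sum over all
  \<open>(k, l, hs)\<close> meets each of them exactly once.\<close>

lemma idx_set_eq:
  assumes "length hs = r"
  shows "idx_set r k l hs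
    = {ks \<in> admissible_lists r. (sum_list ks, length ks, heights r ks) = (k, l, hs)}"
proof (rule Set.set_eqI)
  fix ks
  have "heights r ks = hs \<longleftrightarrow> (\<forall>i<r. height (Suc i) ks = hs ! i)"
    using assms by (auto simp: heights_def list_eq_iff_nth_eq simp del: upt_Suc)
  also have "\<dots> \<longleftrightarrow> (\<forall>i\<in>{1..r}. height i ks = hs ! (i - 1))"
    by (auto simp: Ball_def Suc_le_eq gr0_conv_Suc)
  finally show "ks \<in> idx_set r k l hs
      \<longleftrightarrow> ks \<in> {ks \<in> admissible_lists r. (sum_list ks, length ks, heights r ks) = (k, l, hs)}"
    by (cases ks) (auto simp: idx_set_def admissible_lists_def positive_lists_def)
qed

lemma finite_idx_set: "finite (idx_set r k l hs)"
proof (rule finite_subset)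
  show "idx_set r k l hs \<subseteq> {ks. set ks \<subseteq> {..k} \<and> length ks = l}"
    using member_le_sum_list by (fastforce simp: idx_set_def)
  show "finite {ks. set ks \<subseteq> {..k} \<and> length ks = l}"
    by (rule finite_lists_length_eq) simp
qed

lemma admissible_positive: "admissible_lists r \<subseteq> positive_lists"
  by (auto simp: admissible_lists_def positive_lists_def)

lemma Phi_t_nth:
  assumes "r \<ge> 1"
  shows "fps_nth (Phi_t q t r) n
    = mgsum (\<lambda>ks. fps_nth (qLi_t q t ks) n) (index_mon r) (admissible_lists r)"
proof (rule mpser_eqI)
  fix M
  define c where "c = (\<lambda>ks. fps_nth (qLi_t q t ks) n)"
  define S where "S = {ks \<in> admissible_lists r. index_mon r ks = M}"
  define g where "g = (\<lambda>ks. (sum_list ks, length ks, heights r ks))"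
  define T where "T = (\<lambda>(k, l, hs). mcoeff (mconst (fps_nth (G_t q t r k l hs) n) * xmon r k l hs) M)"
  have T: "T p = (\<Sum>ks | ks \<in> S \<and> g ks = p. c ks)" if "p \<in> {(k, l, hs). length hs = r}" for p
  proof -
    from that obtain k l hs where p: "p = (k, l, hs)" and hs: "length hs = r" by auto
    have "T p = (\<Sum>ks\<in>idx_set r k l hs. c ks * mcoeff (xmon r k l hs) M)"
      by (simp add: T_def p mcoeff_mconst_mult G_t_def fps_sum_nth c_def sum_distrib_right)
    also have "\<dots> = (\<Sum>ks\<in>idx_set r k l hs. if index_mon r ks = M then c ks else 0)"
    proof (rule sum.cong)
      fix ks assume "ks \<in> idx_set r k l hs"
      then have "ks \<in> positive_lists" "(sum_list ks, length ks, heights r ks) = (k, l, hs)"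
        using admissible_positive by (auto simp: idx_set_eq[OF hs])
      then have "xmon r k l hs = (mmon (index_mon r ks) :: 'a mpser)"
        using xmon_index_mon[OF assms] by auto
      then show "c ks * mcoeff (xmon r k l hs) M = (if index_mon r ks = M then c ks else 0)"
        by (auto simp: mmon_def)
    qed simp
    also have "\<dots> = (\<Sum>ks\<in>{ks \<in> idx_set r k l hs. index_mon r ks = M}. c ks)"
      by (simp add: sum.inter_filter finite_idx_set)
    also have "{ks \<in> idx_set r k l hs. index_mon r ks = M} = {ks. ks \<in> S \<and> g ks = p}"
      by (auto simp: idx_set_eq[OF hs] S_def g_def p)
    finally show ?thesis .
  qed
  have S: "finite S"
    unfolding S_def by (rule finite_fibresD[OF finite_fibres_index_mon])
  have "mcoeff (fps_nth (Phi_t q t r) n) M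
      = (\<Sum>p | p \<in> {(k, l, hs). length hs = r} \<and> T p \<noteq> 0. T p)"
    by (simp add: Phi_t_def formal_sum_def T_def case_prod_unfold)
  \<comment> \<open>Parameters outside the image of the finite set \<open>S\<close> have an empty
    fibre and contribute 0; over the image the terms regroup to a sum over \<open>S\<close>.\<close>
  also have "\<dots> = (\<Sum>p\<in>g ` S. T p)"
  proof (rule sum.mono_neutral_left)
    show "{p. p \<in> {(k, l, hs). length hs = r} \<and> T p \<noteq> 0} \<subseteq> g ` S"
    proof
      fix p assume p: "p \<in> {p. p \<in> {(k, l, hs). length hs = r} \<and> T p \<noteq> 0}"
      then have "p \<in> {(k, l, hs). length hs = r}" "T p \<noteq> 0" by blast+
      then have "(\<Sum>ks | ks \<in> S \<and> g ks = p. c ks) \<noteq> 0" by (simp only: T not_False_eq_True)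
      then have "{ks. ks \<in> S \<and> g ks = p} \<noteq> {}" by (metis sum.empty)
      then show "p \<in> g ` S" by blast
    qed
  qed (use S in \<open>auto simp: g_def heights_def\<close>)
  also have "\<dots> = (\<Sum>p\<in>g ` S. \<Sum>ks | ks \<in> S \<and> g ks = p. c ks)"
    by (rule sum.cong) (auto simp: T g_def heights_def)
  also have "\<dots> = sum c S"
    by (rule sum.image_gen[OF S, symmetric])
  finally show "mcoeff (fps_nth (Phi_t q t r) n) M = mcoeff (mgsum (\<lambda>ks. fps_nth (qLi_t q t ks) n)
      (index_mon r) (admissible_lists r)) M"
    by (simp add: mcoeff_mgsum S_def c_def)
qed

section \<open>The transfer recursion\<close>

text \<open>The state of the recursion in n. The first part is unrestricted and the empty index is
  included, because the sum describes the tail of a longer index.\<close>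

definition qLi_sum :: "'k::field \<Rightarrow> 'k \<Rightarrow> nat \<Rightarrow> nat \<Rightarrow> 'k mpser" where
  "qLi_sum q t r n = mgsum (\<lambda>ks. \<Sum>m<n. fps_nth (qLi_t q t ks) m) (index_mon r) positive_lists"

section \<open>Polynomials from clearing denominators\<close>

definition parts_poly :: "nat \<Rightarrow> 'a::comm_ring_1 \<Rightarrow> (nat \<Rightarrow> 'a) \<Rightarrow> 'a" where
  "parts_poly r N x = (\<Sum>k=1..r. N ^ (r - k) * (N - x 1) * x (k + 1)) + x (r + 2)"

text \<open>For N = [m], \<open>parts_poly\<close> stands for N^r (N - x_1) W. Thus s = 1 - t and s
  = -t give the numerator and the denominator of the transfer factor.\<close>

definition shifted_poly :: "nat \<Rightarrow> 'a::comm_ring_1 \<Rightarrow> 'a \<Rightarrow> (nat \<Rightarrow> 'a) \<Rightarrow> 'a" where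
  "shifted_poly r s N x = N ^ r * (N - x 1) + s * parts_poly r N x"

text \<open>Neighbouring terms meet in the same power of N, which produces the coefficients x_{j+1}
  - x_1 x_j in the equations for \<alpha> and \<beta>. The induction on r is Horner's
  scheme.\<close>

lemma parts_poly_expand:
  "parts_poly r N x = x 2 * N ^ r + (\<Sum>j=2..r+1. (x (j + 1) - x 1 * x j) * N ^ (r + 1 - j))"
proof (induction r)
  case 0
  then show ?case by (simp add: parts_poly_def numeral_2_eq_2)
next
  case (Suc r)
  have "(\<Sum>k=1..r. N ^ (Suc r - k) * (N - x 1) * x (k + 1))
      = N * (\<Sum>k=1..r. N ^ (r - k) * (N - x 1) * x (k + 1))"
    by (simp add: sum_distrib_left Suc_diff_le mult.assoc)
  then have "parts_poly (Suc r) N x = N * parts_poly r N x + (x (r + 3) - x 1 * x (r + 2))"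
    by (simp add: parts_poly_def algebra_simps numeral_3_eq_3)
  moreover have "(\<Sum>j=2..r+1. (x (j + 1) - x 1 * x j) * N ^ (Suc r + 1 - j))
      = N * (\<Sum>j=2..r+1. (x (j + 1) - x 1 * x j) * N ^ (r + 1 - j))"
    unfolding sum_distrib_left by (rule sum.cong) (auto simp: Suc_diff_le)
  ultimately show ?case
    unfolding Suc by (simp add: algebra_simps numeral_3_eq_3)
qed

text \<open>Vieta's expansion: the subsets of factors contributing \<open>y i\<close> are sorted by
  cardinality.\<close>

lemma prod_add_esym:
  fixes y :: "nat \<Rightarrow> 'a::comm_ring_1"
  shows "(\<Prod>i=1..m. N + y i) = (\<Sum>j=0..m. esym m y j * N ^ (m - j))"
proof -
  have "(\<Prod>i=1..m. N + y i) = (\<Sum>S\<in>Pow {1..m}. (\<Prod>i\<in>S. y i) * (\<Prod>i\<in>{1..m} - S. N))"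
    by (subst prod_add[symmetric]) (simp_all add: add.commute)
  also have "\<dots> = (\<Sum>S\<in>Pow {1..m}. (\<Prod>i\<in>S. y i) * N ^ (m - card S))"
    by (rule sum.cong) (auto simp: card_Diff_subset finite_subset)
  also have "\<dots> = (\<Sum>j=0..m. \<Sum>S | S \<in> Pow {1..m} \<and> card S = j. (\<Prod>i\<in>S. y i) * N ^ (m - card S))"
  proof (rule sum.group[symmetric])
    show "card ` Pow {1..m} \<subseteq> {0..m}"
      using card_mono[of "{1..m}"] by auto
  qed auto
  also have "\<dots> = (\<Sum>j=0..m. esym m y j * N ^ (m - j))"
    by (simp add: esym_def sum_distrib_right)
  finally show ?thesis .
qed

text \<open>The prescribed symmetric functions are the coefficients of \<open>shifted_poly\<close>
  as a polynomial in N. The case s = 1 - t applies to \<alpha>, the case s = -t to \<beta>.\<close>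

lemma prod_shift_eq:
  fixes y :: "nat \<Rightarrow> 'a::comm_ring_1"
  assumes "r \<ge> 1" "(\<Sum>i=1..r+1. y i) = s * x 2 - x 1"
    and "\<And>j. j \<in> {2..r+1} \<Longrightarrow> esym (r+1) y j = s * (x (j+1) - x 1 * x j)"
  shows "(\<Prod>i=1..r+1. N + y i) = shifted_poly r s N x"
proof -
  have e0: "esym (r+1) y 0 = 1"
  proof -
    have "{S. S \<subseteq> {1..r+1} \<and> card S = 0} = {{}}"
      using finite_subset by (auto simp: card_eq_0_iff)
    then show ?thesis unfolding esym_def by simp
  qed
  have e1: "esym (r+1) y 1 = (\<Sum>i=1..r+1. y i)"
  proof -
    have "{S. S \<subseteq> {1..r+1} \<and> card S = 1} = (\<lambda>i. {i}) ` {1..r+1}"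
      by (auto simp: card_1_singleton_iff)
    then show ?thesis unfolding esym_def by (simp add: sum.reindex)
  qed
  have "(\<Prod>i=1..r+1. N + y i) = (\<Sum>j=0..r+1. esym (r+1) y j * N ^ (r + 1 - j))"
    by (rule prod_add_esym)
  also have "\<dots> = N ^ (r + 1) + (\<Sum>i=1..r+1. y i) * N ^ r
      + (\<Sum>j=2..r+1. esym (r+1) y j * N ^ (r + 1 - j))"
    using e0 e1 by (simp add: sum.atLeast_Suc_atMost numeral_2_eq_2 del: sum.cl_ivl_Suc)
  also have "(\<Sum>j=2..r+1. esym (r+1) y j * N ^ (r + 1 - j))
      = s * (\<Sum>j=2..r+1. (x (j + 1) - x 1 * x j) * N ^ (r + 1 - j))"
    unfolding sum_distrib_left by (rule sum.cong) (simp_all only: assms(3) mult.assoc)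
  also have "N ^ (r + 1) + (\<Sum>i=1..r+1. y i) * N ^ r + \<dots> = shifted_poly r s N x"
    unfolding assms(2) shifted_poly_def parts_poly_expand by (simp add: algebra_simps)
  finally show ?thesis .
qed

text \<open>The finitely many parts k \<le> r give the sum in \<open>parts_poly\<close>; all larger
  parts together give its last summand x_{r+2}.\<close>

lemma mgsum_parts:
  fixes N :: "'k::field"
  assumes "N \<noteq> 0"
  shows "mconst N ^ r * (mconst N - mvar 1) * mgsum (\<lambda>k. 1 / N ^ k) (part_mon r) {1..}
    = parts_poly r (mconst N) mvar"
proof -
  have split: "{1..} = {1..r} \<union> {r+1..}" by auto
  have "mgsum (\<lambda>k. 1 / N ^ k) (part_mon r) {1..}
      = mgsum (\<lambda>k. 1 / N ^ k) (part_mon r) {1..r} + mgsum (\<lambda>k. 1 / N ^ k) (part_mon r) {r+1..}"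
    unfolding split by (rule mgsum_Un) (auto simp: finite_fibres_part_mon)
  moreover have "mconst N ^ r * (mconst N - mvar 1) * mgsum (\<lambda>k. 1 / N ^ k) (part_mon r) {1..r}
      = (\<Sum>k=1..r. mconst N ^ (r - k) * (mconst N - mvar 1) * mvar (k + 1))"
    unfolding mgsum_finite[OF finite_atLeastAtMost] sum_distrib_left
  proof (rule sum.cong)
    fix k assume k: "k \<in> {1..r}"
    then have "mconst N ^ r * mconst (1 / N ^ k) = mconst N ^ (r - k)"
      using assms unfolding mconst_power[symmetric] mconst_hom(4)[symmetric]
      by (simp add: power_diff)
    moreover have "mmon (part_mon r k) = (mvar (k + 1) :: 'k mpser)"
      using k by (simp add: part_mon_def mvar_def)
    ultimately show "mconst N ^ r * (mconst N - mvar 1) * (mconst (1 / N ^ k) * mmon (part_mon r k))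
        = mconst N ^ (r - k) * (mconst N - mvar 1) * mvar (k + 1)"
      by (metis (no_types, lifting) mult.assoc mult.commute)
  qed simp
  ultimately show ?thesis
    using mgsum_parts_tail[OF assms, of r] by (simp add: parts_poly_def distrib_left)
qed

section \<open>Generating functions over all indices\<close>

lemma positive_lists_split:
  "positive_lists = {[]} \<union> {k # ks | k ks. k \<in> {1..} \<and> ks \<in> positive_lists}"
proof (rule Set.set_eqI)
  fix ks
  show "ks \<in> positive_lists
      \<longleftrightarrow> ks \<in> {[]} \<union> {k # ks | k ks. k \<in> {1..} \<and> ks \<in> positive_lists}"
    by (cases ks) (auto simp: positive_lists_def)
qed

lemma mgsum_positive_lists:
  "mgsum c (index_mon r) positive_lists = mconst (c [])
    + mgsum c (index_mon r) {k # ks | k ks. k \<in> {1..} \<and> ks \<in> positive_lists}"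
proof -
  have "mgsum c (index_mon r) {[]} = mconst (c [])"
    by (simp add: mgsum_finite mmon_empty)
  then show ?thesis
    by (subst positive_lists_split, subst mgsum_Un) (auto simp: finite_fibres_index_mon)
qed

text \<open>The initial value of the recursion: among all indices only the empty one has a constant
  term.\<close>

lemma qLi_sum_1: "qLi_sum q t r 1 = 1"
proof -
  have "mgsum (\<lambda>ks. fps_nth (qLi_t q t ks) 0) (index_mon r) {k # ks | k ks. k \<in> {1..} \<and> ks \<in> positive_lists}
      = mgsum (\<lambda>_. 0) (index_mon r) {k # ks | k ks. k \<in> {1..} \<and> ks \<in> positive_lists}"
    by (rule mgsum_cong) (auto simp: qLi_t_nth_0)
  also have "\<dots> = 0"
    by (rule mpser_eqI) (simp add: mcoeff_mgsum)
  finally show ?thesis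
    by (simp add: qLi_sum_def mgsum_positive_lists qLi_t_Nil_nth)
qed

text \<open>The set \<open>K\<close> of first parts is left open: all parts give the recursion, the
  parts above r give \<open>Phi_t\<close>.\<close>

lemma mgsum_qLi_t_Cons:
  assumes "n \<ge> 1"
  shows "mgsum (\<lambda>ks. fps_nth (qLi_t q t ks) n) (index_mon r) {k # ks | k ks. k \<in> K \<and> ks \<in> positive_lists}
    = mgsum (\<lambda>k. 1 / qint q n ^ k) (part_mon r) K
      * (qLi_sum q t r n
         + mconst t * mgsum (\<lambda>ks. fps_nth (qLi_t q t ks) n) (index_mon r) positive_lists)"
  unfolding qLi_sum_def mgsum_scale[symmetric] mgsum_add[symmetric]
  by (rule mgsum_Cons) (rule qLi_t_Cons_nth[OF assms])

section \<open>Constants and constant terms\<close>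

lemma mconst_minus [simp]: "mconst (c - d) = mconst c - mconst d" "mconst (- c) = - mconst c"
  by (rule mpser_eqI, simp add: mconst_def minus_mpser.rep_eq uminus_mpser.rep_eq)+

lemma mcoeff_mult_empty [simp]: "mcoeff (f * g) {#} = mcoeff f {#} * mcoeff g {#}"
proof -
  have "{(A :: nat multiset, B). A + B = {#}} = {({#}, {#})}" by auto
  then show ?thesis by (simp add: mcoeff_mult)
qed

lemma mcoeff_empty_simps [simp]:
  "mcoeff 1 {#} = 1" "mcoeff (f - g) {#} = mcoeff f {#} - mcoeff g {#}"
  "mcoeff (mconst c) {#} = c" "mcoeff (mvar i) {#} = 0"
  by (simp_all add: one_mpser.rep_eq minus_mpser.rep_eq mconst_def mvar_def mmon_def)

lemma mcoeff_power_empty [simp]: "mcoeff (f ^ n) {#} = mcoeff f {#} ^ n"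
  by (induction n) simp_all

text \<open>Setting all variables to 0 leaves m^(r+1).\<close>

lemma shifted_poly_nonzero:
  fixes m :: "'k::field"
  assumes "m \<noteq> 0"
  shows "shifted_poly r s (mconst m) mvar \<noteq> 0"
proof -
  have "mcoeff (shifted_poly r s (mconst m) mvar) {#} = m ^ r * m"
    by (simp add: shifted_poly_def parts_poly_def mcoeff_sum)
  then show ?thesis using assms by (metis mcoeff_0 no_zero_divisors power_not_zero)
qed

text \<open>The sums A of the coefficients below n and B of those at n satisfy B = W (A + t B),
  since equal entries are weighted by t. Clearing denominators with D and solving for B gives the
  recursion; inserting B into V (A + t B) gives \<open>Phi_t\<close>.\<close>

lemma
  fixes q t :: "'k::field"
  assumes "n \<ge> 1" and "qint q n \<noteq> 0"
  defines "N \<equiv> mconst (qint q n)"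
  shows qLi_sum_Suc: "shifted_poly r (mconst (- t)) N mvar * qLi_sum q t r (Suc n)
      = shifted_poly r (mconst (1 - t)) N mvar * qLi_sum q t r n"
    and Phi_t_qLi_sum: "r \<ge> 1 \<Longrightarrow> shifted_poly r (mconst (- t)) N mvar * fps_nth (Phi_t q t r) n
      = mvar (r + 2) * qLi_sum q t r n"
proof -
  define D where "D = N ^ r * (N - mvar 1)"
  define Y where "Y = parts_poly r N mvar"
  define W where "W = mgsum (\<lambda>k. 1 / qint q n ^ k) (part_mon r) {1..}"
  define V where "V = mgsum (\<lambda>k. 1 / qint q n ^ k) (part_mon r) {r+1..}"
  define A where "A = qLi_sum q t r n"
  define B where "B = mgsum (\<lambda>ks. fps_nth (qLi_t q t ks) n) (index_mon r) positive_lists"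
  let ?t = "mconst t"
  have DW: "D * W = Y" and DV: "D * V = mvar (r + 2)"
    unfolding D_def W_def V_def Y_def N_def
    using mgsum_parts[OF assms(2)] mgsum_parts_tail[OF assms(2)] by blast+
  have shifted: "shifted_poly r s N mvar = D + s * Y" for s
    by (simp add: shifted_poly_def D_def Y_def)
  have B: "B = W * (A + ?t * B)"
    using mgsum_qLi_t_Cons[OF assms(1), of q t r "{1..}"] assms(1)
    unfolding A_def B_def W_def by (subst (1) mgsum_positive_lists) (simp add: qLi_t_Nil_nth)
  have "D * B = Y * (A + ?t * B)"
    using DW B by (metis mult.assoc)
  then have DB: "(D - ?t * Y) * B = Y * A"
    by (simp add: algebra_simps)
  have "qLi_sum q t r (Suc n) = A + B"
    by (simp add: qLi_sum_def A_def B_def mgsum_add)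
  then show "shifted_poly r (mconst (- t)) N mvar * qLi_sum q t r (Suc n)
      = shifted_poly r (mconst (1 - t)) N mvar * qLi_sum q t r n"
    using DB by (simp add: shifted A_def[symmetric] algebra_simps)
  assume r: "r \<ge> 1"
  have C: "fps_nth (Phi_t q t r) n = V * (A + ?t * B)"
    unfolding Phi_t_nth[OF r] admissible_lists_def mgsum_qLi_t_Cons[OF assms(1)]
    by (simp add: V_def A_def B_def)
  \<comment> \<open>D is the case s = 0 of \<open>shifted_poly\<close>.\<close>
  have "D \<noteq> 0"
    using shifted_poly_nonzero[OF assms(2), of r 0, folded N_def] by (simp add: shifted)
  \<comment> \<open>The factor D - t Y eliminates B, after which the terms with Y cancel and D can
    be divided out.\<close>
  have "D * ((D - ?t * Y) * fps_nth (Phi_t q t r) n)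
      = (D * V) * ((D - ?t * Y) * A + ?t * ((D - ?t * Y) * B))"
    unfolding C by (simp add: algebra_simps)
  also have "\<dots> = D * (mvar (r + 2) * A)"
    unfolding DB DV by (simp add: algebra_simps)
  finally show "shifted_poly r (mconst (- t)) N mvar * fps_nth (Phi_t q t r) n
      = mvar (r + 2) * qLi_sum q t r n"
    using \<open>D \<noteq> 0\<close> by (simp add: shifted A_def)
qed

section \<open>Comparison with the basic hypergeometric series\<close>

lemma emb_minus [simp]: "emb (f - g) = emb f - emb g" "emb (- f) = - emb f"
proof -
  have "emb (f - g) + emb g = emb f" by (simp flip: emb_ring_hom)
  then show "emb (f - g) = emb f - emb g" by (simp add: algebra_simps)
  have "emb (- f) + emb f = 0" by (simp flip: emb_ring_hom(3))
  then show "emb (- f) = - emb f" by (simp add: eq_neg_iff_add_eq_0)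
qed

lemma emb_power [simp]: "emb (f ^ n) = emb f ^ n"
  by (induction n) simp_all

lemma emb_sum [simp]: "emb (\<Sum>i\<in>I. f i) = (\<Sum>i\<in>I. emb (f i))"
  by (induction I rule: infinite_finite_induct) simp_all

lemma emb_eq_0_iff [simp]: "emb f = 0 \<longleftrightarrow> f = 0"
  using emb_inject[of f 0] by simp

lemma cst_simps:
  "cst 0 = 0" "cst 1 = 1" "cst (c + d) = cst c + cst d" "cst (c - d) = cst c - cst d"
  "cst (- c) = - cst c" "cst (c * d) = cst c * cst d" "cst (c ^ n) = cst c ^ n"
  by (simp_all add: cst_def)

lemma mconst_eq_0_iff [simp]: "mconst c = 0 \<longleftrightarrow> c = 0"
  by (metis mcoeff_0 mcoeff_empty_simps(3) mconst_hom(1))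

lemma cst_eq_0_iff: "cst c = 0 \<longleftrightarrow> c = 0"
  by (simp add: cst_def)

lemma emb_shifted_poly:
  "emb (shifted_poly r (mconst s) (mconst m) mvar) = shifted_poly r (cst s) (cst m) xvar"
  by (simp add: shifted_poly_def parts_poly_def cst_def xvar_def)

lemma shifted_poly_cst_nonzero:
  fixes m :: "'k::field"
  assumes "m \<noteq> 0"
  shows "shifted_poly r (cst s) (cst m) xvar \<noteq> 0"
  using shifted_poly_nonzero[OF assms] by (simp flip: emb_shifted_poly)

text \<open>Since [1] = 1, the case s = -t is the denominator of the prefactor of the hypergeometric
  series.\<close>

lemma shifted_poly_1:
  assumes "r \<ge> 1"
  shows "shifted_poly r s 1 x = 1 - x 1 + s * x 2
    + s * (\<Sum>j=0..r-1. x (r + 2 - j) - x 1 * x (r + 1 - j))"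
proof -
  have "(\<Sum>j=2..r+1. x (j + 1) - x 1 * x j) = (\<Sum>j=0..r-1. x (r + 2 - j) - x 1 * x (r + 1 - j))"
    using assms by (intro sum.reindex_bij_witness[of _ "\<lambda>j. r + 1 - j" "\<lambda>j. r + 1 - j"])
       (auto simp: Suc_diff_le)
  then show ?thesis
    by (simp only: shifted_poly_def parts_poly_expand power_one mult_1 mult_1_right) (simp add: algebra_simps)
qed

text \<open>The shift \<open>n \<mapsto> n + 1\<close> absorbs the two \<open>q\<close>-powers in which \<open>a\<^sub>i\<close> and \<open>b\<^sub>i\<close> differ.\<close>

lemma one_minus_qshift:
  fixes q y :: "'a::field"
  assumes "1 - q \<noteq> 0" "1 + (1 - q) * y \<noteq> 0"
  shows "1 - q ^ p / (1 + (1 - q) * y) * q ^ n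
    = (1 - q) / (1 + (1 - q) * y) * ((1 - q ^ (n + p)) / (1 - q) + y)"
proof -
  have "(1 - q) * ((1 - q ^ (n + p)) / (1 - q) + y) = 1 + (1 - q) * y - q ^ p * q ^ n"
    using assms(1) by (simp add: distrib_left power_add mult.commute)
  moreover have "1 - q ^ p * q ^ n / (1 + (1 - q) * y)
      = (1 + (1 - q) * y - q ^ p * q ^ n) / (1 + (1 - q) * y)"
    by (subst diff_divide_distrib) (simp add: assms(2))
  ultimately show ?thesis
    by (simp only: times_divide_eq_left)
qed

text \<open>The formal parameter is represented by any nonzero q that is not a root of unity, so an
  indeterminate of a rational function field is covered. Comparing in the closure that contains
  \<alpha> and \<beta> loses nothing, because \<open>emb\<close> is injective.\<close>

theorem theorem3p5:
  fixes r :: nat and q t :: "'k::field"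
    and \<alpha> \<beta> a b :: "nat \<Rightarrow> 'k coeff_field"
  assumes "r \<ge> 1"
    and "q \<noteq> 0" and "\<And>n. n \<ge> 1 \<Longrightarrow> q ^ n \<noteq> 1"
    and "(\<Sum>i=1..r+1. \<alpha> i) = (1 - cst t) * xvar 2 - xvar 1"
    and "\<And>j. j \<in> {2..r+1} \<Longrightarrow>
           esym (r+1) \<alpha> j = (1 - cst t) * (xvar (j+1) - xvar 1 * xvar j)"
    and "(\<Sum>i=1..r+1. \<beta> i) = - (xvar 1 + cst t * xvar 2)"
    and "\<And>j. j \<in> {2..r+1} \<Longrightarrow>
           esym (r+1) \<beta> j = - cst t * (xvar (j+1) - xvar 1 * xvar j)"
    and "\<And>i. i \<in> {1..r+1} \<Longrightarrow> a i = cst q / (1 + (1 - cst q) * \<alpha> i)"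
    and "\<And>i. i \<in> {1..r+1} \<Longrightarrow> b i = (cst q)^2 / (1 + (1 - cst q) * \<beta> i)"
  shows "Abs_fps (\<lambda>n. emb (fps_nth (Phi_t q t r) n)) =
    fps_const (xvar (r+2) /
        (1 - (xvar 1 + cst t * xvar 2)
           - cst t * (\<Sum>j=0..r-1. xvar (r+2-j) - xvar 1 * xvar (r+1-j)))) * fps_X
    * basic_hyp (cst q # map a [1..<r+2]) (map b [1..<r+2]) (cst q)
        (fps_const ((\<Prod>i=1..r+1. b i) / ((cst q)^(r+1) * (\<Prod>i=1..r+1. a i))) * fps_X)"
proof -
  let ?Q = "cst q"
  let ?w = "(\<Prod>i=1..r+1. b i) / (?Q^(r+1) * (\<Prod>i=1..r+1. a i))"
  \<comment> \<open>\<open>A n\<close> and \<open>B n\<close> are the products over i of [n] +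
    \<open>\<alpha> i\<close> and of [n] + \<open>\<beta> i\<close>.\<close>
  define A where "A = (\<lambda>n. shifted_poly r (1 - cst t) (cst (qint q n)) xvar)"
  define B where "B = (\<lambda>n. shifted_poly r (- cst t) (cst (qint q n)) xvar)"
  have q1: "q \<noteq> 1" using assms(3)[of 1] by simp
  then have Q1: "1 - ?Q \<noteq> 0"
    using cst_eq_0_iff[of "1 - q"] by (simp add: cst_simps)
  have Q0: "?Q \<noteq> 0" using assms(2) by (simp add: cst_eq_0_iff)
  have N0: "qint q n \<noteq> 0" if "n \<ge> 1" for n
    using assms(3)[OF that] q1 by (simp add: qint_def)
  have cst_qint: "cst (qint q n) = (1 - ?Q ^ n) / (1 - ?Q)" for n
  proof -
    have "cst (qint q n) * (1 - ?Q) = 1 - ?Q ^ n"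
      using q1 by (simp add: qint_def flip: cst_simps)
    then show ?thesis using Q1 by (simp add: field_simps)
  qed
  have prod_\<alpha>: "(\<Prod>i=1..r+1. N + \<alpha> i) = shifted_poly r (1 - cst t) N xvar" for N
    by (rule prod_shift_eq[OF assms(1,4,5)])
  have prod_\<beta>: "(\<Prod>i=1..r+1. N + \<beta> i) = shifted_poly r (- cst t) N xvar" for N
    by (rule prod_shift_eq) (use assms(1,6,7) in auto)
  \<comment> \<open>Otherwise the product would vanish at N = 1 / (1 - q), a nonzero constant, where
    \<open>shifted_poly\<close> does not. This keeps the denominators of \<open>a i\<close> and
    \<open>b i\<close> away from 0.\<close>
  have nonzero: "1 + (1 - ?Q) * y i \<noteq> 0"
    if "\<And>N. (\<Prod>i=1..r+1. N + y i) = shifted_poly r (cst s) N xvar" "i \<in> {1..r+1}" for y s i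
  proof
    assume "1 + (1 - ?Q) * y i = 0"
    moreover have "cst (1 / (1 - q)) * (1 - ?Q) = 1"
      using q1 by (simp flip: cst_simps)
    ultimately have "(1 - ?Q) * (cst (1 / (1 - q)) + y i) = 0"
      by (simp only: distrib_left mult.commute[of "1 - ?Q" "cst _"])
    then have "cst (1 / (1 - q)) + y i = 0"
      using Q1 by (simp only: mult_eq_0_iff simp_thms)
    then have "(\<Prod>i=1..r+1. cst (1 / (1 - q)) + y i) = 0"
      using that(2) by (intro prod_zero) auto
    then show False
      using shifted_poly_cst_nonzero[of "1 / (1 - q)"] q1 by (simp only: that(1)) simp
  qed
  have nz\<alpha>: "1 + (1 - ?Q) * \<alpha> i \<noteq> 0" if "i \<in> {1..r+1}" for i
    by (rule nonzero[of \<alpha> "1 - t", OF _ that]) (simp only: prod_\<alpha> cst_simps)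
  have nz\<beta>: "1 + (1 - ?Q) * \<beta> i \<noteq> 0" if "i \<in> {1..r+1}" for i
    by (rule nonzero[of \<beta> "- t", OF _ that]) (simp only: prod_\<beta> cst_simps)
  have B0: "B n \<noteq> 0" if "n \<ge> 1" for n
    using shifted_poly_cst_nonzero[OF N0[OF that], of r "- t"] by (simp add: B_def cst_simps)

  \<comment> \<open>Iterating the recursion\<close>
  define S where "S = (\<lambda>n. emb (qLi_sum q t r n))"
  have S1: "S 1 = 1" by (simp add: S_def qLi_sum_1 del: One_nat_def)
  have S_Suc: "B n * S (Suc n) = A n * S n" if "n \<ge> 1" for n
    using arg_cong[OF qLi_sum_Suc[OF that N0[OF that], of r t], of emb]
    unfolding emb_ring_hom emb_shifted_poly by (simp add: A_def B_def S_def cst_simps)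
  have Phi: "B n * emb (fps_nth (Phi_t q t r) n) = xvar (r + 2) * S n" if "n \<ge> 1" for n
    using arg_cong[OF Phi_t_qLi_sum[OF that N0[OF that] assms(1), of t], of emb]
    unfolding emb_ring_hom emb_shifted_poly by (simp add: B_def S_def cst_simps xvar_def)
  \<comment> \<open>Dividing by \<open>B (Suc n)\<close> pairs the numerator at m + 1 with the
    denominator at m + 2 and leaves 1 / B 1 in front; this is why q^2 in \<open>b i\<close> faces q
    in \<open>a i\<close>.\<close>
  have S_closed: "S (Suc n) / B (Suc n) = 1 / B 1 * (\<Prod>m<n. A (m + 1) / B (m + 2))" for n
  proof (induction n)
    case 0
    then show ?case using S1 by simp
  next
    case (Suc n)
    have "S (Suc (Suc n)) = A (Suc n) * (S (Suc n) / B (Suc n))"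
      using S_Suc[of "Suc n"] B0[of "Suc n"] by (simp add: field_simps)
    then show ?case unfolding Suc by simp
  qed

  \<comment> \<open>Term ratio of the basic hypergeometric series\<close>
  have w: "?w = (\<Prod>i=1..r+1. (1 + (1 - ?Q) * \<alpha> i) / (1 + (1 - ?Q) * \<beta> i))"
  proof -
    have "?w = (\<Prod>i=1..r+1. b i / (?Q * a i))"
      by (simp only: prod_dividef prod.distrib prod_constant card_atLeastAtMost) simp
    also have "\<dots> = (\<Prod>i=1..r+1. (1 + (1 - ?Q) * \<alpha> i) / (1 + (1 - ?Q) * \<beta> i))"
      by (rule prod.cong) (use assms(8,9) Q0 in \<open>simp_all add: power2_eq_square\<close>)
    finally show ?thesis .
  qed
  \<comment> \<open>The constants relating 1 - \<open>a i\<close> q^m to [m + 1] +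
    \<open>\<alpha> i\<close> and 1 - \<open>b i\<close> q^m to [m + 2] + \<open>\<beta> i\<close>
    are exactly compensated by \<open>?w\<close>.\<close>
  have ratio: "?w * (\<Prod>i=1..r+1. 1 - a i * ?Q ^ m) / (\<Prod>i=1..r+1. 1 - b i * ?Q ^ m)
      = A (m + 1) / B (m + 2)" for m
  proof -
    have "?w * (\<Prod>i=1..r+1. 1 - a i * ?Q ^ m) / (\<Prod>i=1..r+1. 1 - b i * ?Q ^ m)
        = (\<Prod>i=1..r+1. (1 + (1 - ?Q) * \<alpha> i) / (1 + (1 - ?Q) * \<beta> i)
            * (1 - a i * ?Q ^ m) / (1 - b i * ?Q ^ m))"
      unfolding w by (simp only: prod_dividef prod.distrib)
    also have "\<dots> = (\<Prod>i=1..r+1. (cst (qint q (m + 1)) + \<alpha> i) / (cst (qint q (m + 2)) + \<beta> i))"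
    proof (rule prod.cong)
      fix i assume i: "i \<in> {1..r+1}"
      have "1 - a i * ?Q ^ m = (1 - ?Q) / (1 + (1 - ?Q) * \<alpha> i) * (cst (qint q (m + 1)) + \<alpha> i)"
        using one_minus_qshift[OF Q1 nz\<alpha>[OF i], of 1 m] by (simp add: assms(8)[OF i] cst_qint)
      moreover have "1 - b i * ?Q ^ m
          = (1 - ?Q) / (1 + (1 - ?Q) * \<beta> i) * (cst (qint q (m + 2)) + \<beta> i)"
        using one_minus_qshift[OF Q1 nz\<beta>[OF i], of 2 m] by (simp add: assms(9)[OF i] cst_qint)
      ultimately show "(1 + (1 - ?Q) * \<alpha> i) / (1 + (1 - ?Q) * \<beta> i)
            * (1 - a i * ?Q ^ m) / (1 - b i * ?Q ^ m)
          = (cst (qint q (m + 1)) + \<alpha> i) / (cst (qint q (m + 2)) + \<beta> i)"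
        using Q1 nz\<alpha>[OF i] nz\<beta>[OF i] by simp
    qed simp
    also have "\<dots> = A (m + 1) / B (m + 2)"
      by (simp only: prod_dividef prod_\<alpha> prod_\<beta> A_def B_def)
    finally show ?thesis .
  qed
  have qpochs: "qpochs (map y [1..<r+2]) ?Q n = (\<Prod>m<n. \<Prod>i=1..r+1. 1 - y i * ?Q ^ m)" for y n
  proof -
    have "qpochs (map y [1..<r+2]) ?Q n = (\<Prod>i=1..r+1. qpoch (y i) ?Q n)"
      unfolding qpochs_def
      by (simp add: atLeastLessThanSuc_atLeastAtMost del: upt_Suc prod.cl_ivl_Suc
          flip: prod.distinct_set_conv_list)
    then show ?thesis unfolding qpoch_def by (simp only: prod.swap[of _ "{..<n}"])
  qed
  \<comment> \<open>Nonzero as q is not a root of unity, so the upper parameter q cancels against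
    the same factor in the denominator.\<close>
  have qpoch_q: "qpoch ?Q ?Q n \<noteq> 0" for n
  proof -
    have "1 - ?Q * ?Q ^ m \<noteq> 0" for m
      using assms(3)[of "Suc m"] cst_eq_0_iff[of "1 - q ^ Suc m"] by (simp add: cst_simps)
    then show ?thesis by (simp add: qpoch_def)
  qed
  have coeff: "?w ^ n * (qpochs (?Q # map a [1..<r+2]) ?Q n / qpochs (?Q # map b [1..<r+2]) ?Q n)
      = (\<Prod>m<n. A (m + 1) / B (m + 2))" for n
  proof -
    have Cons: "qpochs (?Q # ys) ?Q n = qpoch ?Q ?Q n * qpochs ys ?Q n" for ys
      by (simp add: qpochs_def)
    have "?w ^ n * (qpochs (?Q # map a [1..<r+2]) ?Q n / qpochs (?Q # map b [1..<r+2]) ?Q n)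
        = ?w ^ n * ((\<Prod>m<n. \<Prod>i=1..r+1. 1 - a i * ?Q ^ m) / (\<Prod>m<n. \<Prod>i=1..r+1. 1 - b i * ?Q ^ m))"
      unfolding Cons qpochs using qpoch_q by (simp del: prod.cl_ivl_Suc)
    also have "\<dots> = (\<Prod>m<n. ?w * (\<Prod>i=1..r+1. 1 - a i * ?Q ^ m) / (\<Prod>i=1..r+1. 1 - b i * ?Q ^ m))"
      by (simp only: prod_dividef prod.distrib prod_constant card_lessThan times_divide_eq_right
          power_divide power_mult_distrib)
    finally show ?thesis unfolding ratio .
  qed
  have B1: "B 1 = 1 - (xvar 1 + cst t * xvar 2)
      - cst t * (\<Sum>j=0..r-1. xvar (r+2-j) - xvar 1 * xvar (r+1-j))"
  proof -
    have "qint q 1 = 1" using q1 by (simp add: qint_def)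
    then show ?thesis unfolding B_def by (simp only: shifted_poly_1[OF assms(1)] cst_simps) simp
  qed

  \<comment> \<open>Comparison of coefficients\<close>
  show ?thesis
  proof (rule fps_ext)
    fix n
    show "fps_nth (Abs_fps (\<lambda>n. emb (fps_nth (Phi_t q t r) n))) n = fps_nth (fps_const (xvar (r+2) /
        (1 - (xvar 1 + cst t * xvar 2)
           - cst t * (\<Sum>j=0..r-1. xvar (r+2-j) - xvar 1 * xvar (r+1-j)))) * fps_X
    * basic_hyp (?Q # map a [1..<r+2]) (map b [1..<r+2]) ?Q (fps_const ?w * fps_X)) n"
    proof (cases n)
      case 0
      \<comment> \<open>Admissible indices are nonempty, so there is no constant term, in agreement
        with the factor z on the right.\<close>
      have "fps_nth (Phi_t q t r) 0 = 0"
        unfolding Phi_t_nth[OF assms(1)]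
        by (rule mpser_eqI) (auto simp: mcoeff_mgsum admissible_lists_def qLi_t_nth_0 intro!: sum.neutral)
      with 0 show ?thesis by (simp add: mult.assoc)
    next
      case (Suc n')
      have "emb (fps_nth (Phi_t q t r) n) = xvar (r + 2) * (S (Suc n') / B (Suc n'))"
        using Phi[of n] B0[of n] Suc by (simp add: field_simps)
      also have "\<dots> = xvar (r + 2) / B 1 * (\<Prod>m<n'. A (m + 1) / B (m + 2))"
        by (simp add: S_closed)
      \<comment> \<open>Composition with the linear series multiplies the coefficient of order n' by
        the n'-th power of \<open>?w\<close>; the factor z accounts for the step from n' to
        n.\<close>
      finally show ?thesis
        unfolding basic_hyp_def fps_compose_linear B1[symmetric] coeff[symmetric]
        by (simp add: Suc mult.assoc del: upt_Suc prod.cl_ivl_Suc)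
    qed
  qed
qed

end
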